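(* Let $\{(p_n,\mathcal D_n,L_n)\}_{n\ge1}$ be a sequence of Hadamard triples on $\mathbb R$ (with $p_n>1$ integers, $0\in\mathcal D_n\subset\{0,1,2,\dots\}$) such that $\sup_n\max\{p_n^{-1}d:d\in\mathcal D_n\}<\infty$ and $\sup_n\#\mathcal D_n<\infty$. If $\limsup_{k\to\infty}T_{p_k,\mathcal D_k}\supset(0,1)$ and $\sup_np_n<\infty$, then there is a subsequence $\{\nu_{n_k}\}$ which is an equi-positive family. In particular, $\mu_{\{p_n,\mathcal D_n\}}$ is a spectral measure.
   Context: A Hadamard triple on $\mathbb R$ is a triple $(p,\mathcal D,L)$ with $p>1$ an integer, $\mathcal D,L\subset\mathbb Z$ finite with $\#\mathcal D=\#L$, such that $\frac{1}{\sqrt{\#\mathcal D}}\big[e^{2\pi i d\ell/p}\big]_{\ell\in L,d\in\mathcal D}$ is unitary. For finite $A\subset\mathbb R$, $\delta_A=\frac{1}{\#A}\sum_{a\in A}\delta_a$; $\widehat\mu(\xi)=\int e^{2\pi ix\xi}d\mu(x)$. $\mu_{\{p_n,\mathcal D_n\}}=\delta_{p_1^{-1}\mathcal D_1}*\delta_{(p_1p_2)^{-1}\mathcal D_2}*\cdots$ (weak limit of finite convolutions) and $\nu_n=\delta_{p_{n+1}^{-1}\mathcal D_{n+1}}*\delta_{(p_{n+1}p_{n+2})^{-1}\mathcal D_{n+2}}*\cdots$. For an integer $p>1$ and finite $D\subset\mathbb Z$, $T_{p,D}$ is the set of $\xi\in[0,1)$ for which there exist distinct $\ell_1,\ell_2\in\{0,\dots,p-1\}$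 with $\widehat{\delta_{p^{-1}D}}(\xi+\ell_i)\ne0$, $i=1,2$; $\limsup_kT_{p_k,\mathcal D_k}=\bigcap_{n\ge1}\bigcup_{k\ge n}T_{p_k,\mathcal D_k}$. A family $\Phi$ of probability measures on $\mathbb R$ is equi-positive if there is $\epsilon_0>0$ such that for all $x\in[0,1)$ and $\nu\in\Phi$ there is $k\in\mathbb Z$ with $|\widehat\nu(x+k)|>\epsilon_0$. A probability measure is spectral if some exponential family $\{e^{2\pi i\lambda x}\}_{\lambda\in\Lambda}$, $\Lambda\subset\mathbb R$ countable, is an orthogonal basis of $L^2(\mu)$. *)

theory Defs
  imports "HOL-Probability.Probability" "HOL-Probability.Convolution"
begin

text \<open>Hadamard triple (p, D, L): p > 1, D, L finite sets of integers of equal cardinality,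
  and the matrix M = (1/sqrt(card D)) [exp(2 pi i d l / p)]_{l in L, d in D} is unitary,
  i.e. M M^* = I, written out entrywise.\<close>
definition hadamard_triple :: "int \<Rightarrow> int set \<Rightarrow> int set \<Rightarrow> bool" where
  "hadamard_triple p D L \<longleftrightarrow> p > 1 \<and> finite D \<and> finite L \<and> card D = card L \<and>
     (\<forall>l1\<in>L. \<forall>l2\<in>L.
        (\<Sum>d\<in>D. (1 / of_nat (card D)) *
            cis (2 * pi * of_int d * of_int l1 / of_int p) *
            cnj (cis (2 * pi * of_int d * of_int l2 / of_int p)))
        = (if l1 = l2 then 1 else 0))"

definition delta :: "real set \<Rightarrow> real measure" where
  "delta A = distr (measure_pmf (pmf_of_set A)) borel (\<lambda>x. x)"

definition fourier :: "real measure \<Rightarrow> real \<Rightarrow> complex" where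
  "fourier M \<xi> = (CLINT x|M. cis (2 * pi * x * \<xi>))"

fun conv_part :: "(nat \<Rightarrow> int) \<Rightarrow> (nat \<Rightarrow> int set) \<Rightarrow> nat \<Rightarrow> nat \<Rightarrow> real measure" where
  "conv_part p D n 0 = return borel 0"
| "conv_part p D n (Suc m) = (conv_part p D n m \<star>
     delta ((\<lambda>d. of_int d / (\<Prod>i\<in>{n+1..n+Suc m}. of_int (p i))) ` D (n + Suc m)))"

definition nu :: "(nat \<Rightarrow> int) \<Rightarrow> (nat \<Rightarrow> int set) \<Rightarrow> nat \<Rightarrow> real measure" where
  "nu p D n = (THE M. real_distribution M \<and> weak_conv_m (conv_part p D n) M)"

definition inf_conv :: "(nat \<Rightarrow> int) \<Rightarrow> (nat \<Rightarrow> int set) \<Rightarrow> real measure" where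
  "inf_conv p D = nu p D 0"

definition T_set :: "int \<Rightarrow> int set \<Rightarrow> real set" where
  "T_set p D = {\<xi>. 0 \<le> \<xi> \<and> \<xi> < 1 \<and>
     (\<exists>l1 l2. l1 \<in> {0..p-1} \<and> l2 \<in> {0..p-1} \<and> l1 \<noteq> l2 \<and>
        fourier (delta ((\<lambda>d. of_int d / of_int p) ` D)) (\<xi> + of_int l1) \<noteq> 0 \<and>
        fourier (delta ((\<lambda>d. of_int d / of_int p) ` D)) (\<xi> + of_int l2) \<noteq> 0)}"

definition equi_positive :: "real measure set \<Rightarrow> bool" where
  "equi_positive \<Phi> \<longleftrightarrow> (\<exists>\<epsilon>0>0. \<forall>x\<in>{0..<1}. \<forall>M\<in>\<Phi>.
      \<exists>k::int. norm (fourier M (x + of_int k)) > \<epsilon>0)"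

text \<open>Spectral measure: some countable family of exponentials e_lambda(x) = exp(2 pi i lambda x)
  is an orthogonal basis of L^2(mu): pairwise orthogonal, and complete (only the zero
  element of L^2(mu) is orthogonal to all of them).\<close>
definition spectral :: "real measure \<Rightarrow> bool" where
  "spectral M \<longleftrightarrow> prob_space M \<and> (\<exists>\<Lambda>::real set. countable \<Lambda> \<and>
     (\<forall>a1\<in>\<Lambda>. \<forall>a2\<in>\<Lambda>. a1 \<noteq> a2 \<longrightarrow>
        (CLINT x|M. cis (2 * pi * a1 * x) * cnj (cis (2 * pi * a2 * x))) = 0) \<and>
     (\<forall>f::real \<Rightarrow> complex. f \<in> borel_measurable M \<and> integrable M (\<lambda>x. (norm (f x))^2) \<and>
        (\<forall>a\<in>\<Lambda>. (CLINT x|M. f x * cnj (cis (2 * pi * a * x))) = 0)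
        \<longrightarrow> (AE x in M. f x = 0)))"

end

theory Submission
  imports Defs
begin

text \<open>
  Write \<open>g n\<close> for the Fourier transform of \<open>nu p D n\<close>. It satisfies
  \<open>g n x = m ((x + l) / p (n + 1)) * g (n + 1) ((x + l) / p (n + 1))\<close> up to integer translations of the
  arguments, so a point at which all \<open>g n (x + k)\<close> are small passes this property on to all its
  children \<open>(x + l) / p (n + 1)\<close> of non-negligible weight \<open>|m|\<close>. On the other hand \<open>g n\<close> is a limit of convex
  combinations of exponentials with bounded frequencies and \<open>g n 0 = 1\<close>, so interpolation bounds the
  number of separated points in \<open>[0, 1)\<close> at which it can be small. Hence it suffices that every
  set of such points eventually branches, with control on the weights lost meanwhile. A point without two
  children of definite weight is close to a rational point of bounded denominator having only one child. Such a
  rational point \<open>a / q\<close> keeps its denominator, does not lose weight, and forces \<open>1 / q\<close> out of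
  \<open>T\<close>; since \<open>1 / q\<close> lies in \<open>T\<close> infinitely often, this stops.

  Given a uniform lower bound, frequencies are chosen recursively so that the tail factor \<open>g n\<close> is
  bounded below on them. The Parseval identities of the partial convolutions then pass to the limit.
\<close>

section \<open>Exponentials and Hadamard triples\<close>

text \<open>Nothing bounds the wait until \<open>1 / q\<close> lies in \<open>T\<close>, so a factor
  lost at every level would ruin uniformity in \<open>n\<close>. Therefore only exact rational
  points are followed, along which the weight is exactly 1; a set merely close to them is compared
  with them once, by a Lipschitz bound, at its own level. Bounded \<open>p n\<close> and bounded
  digits put these rational points on one grid, finite modulo 1, on which the least nonzero weight
  is positive. A branching adds a point but divides the separation by up to \<open>P\<close> and
  multiplies the lower bound by a fixed weight. Only boundedly many branchings occur: the claim for
  sets of \<open>s\<close> points is deduced from the claim for \<open>s + 1\<close> points and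
  every separation, downwards from an \<open>s\<close> with
  \<open>(4 * pi * B) ^ s / s! \<le> 1 / 2\<close>, where interpolation settles it, to
  \<open>s = 1\<close>. A single point of the set has to branch; each of the others follows one
  heavy child, which Parseval's identity provides.\<close>

definition ee :: "real \<Rightarrow> complex" where "ee t = cis (2 * pi * t)"

lemma ee_add: "ee (a + b) = ee a * ee b"
  by (simp add: ee_def cis_mult distrib_left)

lemma ee_0 [simp]: "ee 0 = 1"
  by (simp add: ee_def)

lemma ee_of_int [simp]: "ee (of_int k) = 1"
  by (simp add: ee_def cis_multiple_2pi)

lemma norm_ee [simp]: "norm (ee t) = 1"
  by (simp add: ee_def)

lemma cnj_ee: "cnj (ee t) = ee (- t)"
  by (simp add: ee_def cis_cnj)

lemma ee_diff: "ee (a - b) = ee a * cnj (ee b)"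
  using ee_add[of a "- b"] by (simp add: cnj_ee)

lemma ee_add_int: "ee (a + of_int k) = ee a"
  by (simp add: ee_add)

lemma ee_eq_1_iff: "ee t = 1 \<longleftrightarrow> t \<in> \<int>"
proof
  assume "ee t = 1"
  then have "cos (2 * pi * t) = 1"
    by (metis Re_complex_of_real cis.sel(1) ee_def of_real_1)
  then obtain k :: int where "2 * pi * t = of_int k * 2 * pi"
    using cos_one_2pi_int by blast
  then have "t = of_int k" by simp
  then show "t \<in> \<int>" by simp
qed (auto elim: Ints_cases)

lemma continuous_ee [continuous_intros]:
  "continuous_on A f \<Longrightarrow> continuous_on A (\<lambda>x. ee (f x))"
  unfolding ee_def cis_conv_exp by (intro continuous_intros)

lemma borel_measurable_ee [measurable]: "ee \<in> borel_measurable borel"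
  by (intro borel_measurable_continuous_onI continuous_intros)

lemma has_vector_derivative_ee:
  "((\<lambda>t. ee (y * t)) has_vector_derivative (2 * pi * y) *\<^sub>R (\<i> * ee (y * t))) (at t within A)"
proof -
  have "((\<lambda>t. cis (2 * pi * y * t)) has_vector_derivative (2 * pi * y) *\<^sub>R (\<i> * cis (2 * pi * y * t))) (at t within A)"
    unfolding cis_conv_exp
    by (rule has_vector_derivative_real_field[THEN has_vector_derivative_eq_rhs] derivative_eq_intros | simp add: scaleR_conv_of_real)+
  then show ?thesis by (simp add: ee_def mult.assoc)
qed

lemma norm_ee_diff_le: "norm (ee a - ee b) \<le> 2 * pi * \<bar>a - b\<bar>"
proof -
  have "norm (ee a - ee b) = norm (ee b * (ee (a - b) - 1))"
    using ee_add[of b "a - b"] by (simp add: algebra_simps)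
  also have "\<dots> = norm (cis (2 * pi * (a - b)) - 1)"
    by (simp add: norm_mult ee_def)
  also have "\<dots> \<le> \<bar>2 * pi * (a - b)\<bar>"
    using iexp_approx1[of "2 * pi * (a - b)" 0] by (simp add: cis_conv_exp)
  finally show ?thesis by (simp add: abs_mult)
qed

text \<open>The mask of \<open>D\<close>: the Fourier transform of the uniform measure on
  \<open>D\<close>, with period 1 because digits are integers. Its dilations are the factors of the
  infinite product, see \<open>fourier_delta\<close>.\<close>

definition dmask :: "int set \<Rightarrow> real \<Rightarrow> complex" where
  "dmask D y = (\<Sum>d\<in>D. ee (of_int d * y)) / of_nat (card D)"

lemma dmask_0: "finite D \<Longrightarrow> D \<noteq> {} \<Longrightarrow> dmask D 0 = 1"
  by (simp add: dmask_def)

lemma dmask_add_int: "dmask D (y + of_int k) = dmask D y"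
proof -
  have "ee (of_int d * (y + of_int k)) = ee (of_int d * y)" for d
    using ee_add_int[of "of_int d * y" "d * k"] by (simp add: algebra_simps)
  then show ?thesis by (simp add: dmask_def)
qed

lemma norm_dmask_le_1: "norm (dmask D y) \<le> 1"
proof (cases "finite D \<and> D \<noteq> {}")
  case True
  have "norm (\<Sum>d\<in>D. ee (of_int d * y)) \<le> of_nat (card D)"
    by (rule order_trans[OF norm_sum]) simp
  then show ?thesis using True by (simp add: dmask_def norm_divide divide_simps card_gt_0_iff)
qed (auto simp: dmask_def)

lemma hadamard_row:
  assumes "hadamard_triple p D L" "l1 \<in> L" "l2 \<in> L" "l1 \<noteq> l2"
  shows "dmask D (of_int (l1 - l2) / of_int p) = 0"
proof -
  have "(\<Sum>d\<in>D. (1 / of_nat (card D)) *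
            cis (2 * pi * of_int d * of_int l1 / of_int p) *
            cnj (cis (2 * pi * of_int d * of_int l2 / of_int p))) = (0::complex)"
    using assms unfolding hadamard_triple_def by auto
  moreover have "cis (2 * pi * of_int d * of_int l1 / of_int p) *
            cnj (cis (2 * pi * of_int d * of_int l2 / of_int p)) =
           ee (of_int d * (of_int (l1 - l2) / of_int p))" for d
    by (simp add: ee_def cis_cnj cis_mult) (simp add: algebra_simps diff_divide_distrib)
  ultimately show ?thesis
    by (simp add: dmask_def sum_divide_distrib)
qed

lemma sum_rotate3:
  "(\<Sum>a\<in>A. \<Sum>b\<in>B. \<Sum>c\<in>C. f a b c) = (\<Sum>b\<in>B. \<Sum>c\<in>C. \<Sum>a\<in>A. f a b c)"
  by (subst sum.swap) (intro sum.cong refl sum.swap)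

text \<open>The definition of a Hadamard triple only gives \<open>M M* = I\<close>. If
  \<open>G\<close> is the row of \<open>M* M\<close> at \<open>d\<close>, this makes its squared
  norm equal to \<open>G d = 1\<close>, which forces \<open>G\<close> to be the unit vector at
  \<open>d\<close>.\<close>

lemma hadamard_column:
  assumes had: "hadamard_triple p D L" and dD: "d \<in> D" "d' \<in> D"
  shows "(\<Sum>l\<in>L. ee (of_int (d' - d) * of_int l / of_int p)) = (if d = d' then of_nat (card D) else 0)"
proof -
  define N where "N = card D"
  have fin: "finite D" "finite L" "card L = N"
    using had by (auto simp: hadamard_triple_def N_def)
  have N: "N > 0" using dD fin by (auto simp: N_def card_gt_0_iff)
  define G where "G = (\<lambda>c. (\<Sum>l\<in>L. ee (of_int (c - d) * of_int l / of_int p)) / of_nat N)"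
  have Gd: "G d = 1" using fin N by (simp add: G_def)
  have "(\<Sum>c\<in>D. G c * cnj (G c)) =
     (\<Sum>c\<in>D. \<Sum>l\<in>L. \<Sum>l'\<in>L. ee (of_int (c - d) * of_int l / of_int p) * cnj (ee (of_int (c - d) * of_int l' / of_int p)) / (of_nat N)\<^sup>2)"
    by (simp add: G_def sum_product sum_divide_distrib[symmetric] power2_eq_square)
  also have "\<dots> = (\<Sum>c\<in>D. \<Sum>l\<in>L. \<Sum>l'\<in>L. ee (of_int c * (of_int (l - l') / of_int p)) * ee (- of_int d * of_int (l - l') / of_int p) / (of_nat N)\<^sup>2)"
    by (intro sum.cong refl arg_cong2[where f="(/)"])
       (simp add: ee_diff[symmetric] ee_add[symmetric], rule arg_cong[where f=ee], simp add: algebra_simps diff_divide_distrib add_divide_distrib)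
  also have "\<dots> = (\<Sum>l\<in>L. \<Sum>l'\<in>L. \<Sum>c\<in>D. ee (of_int c * (of_int (l - l') / of_int p)) * ee (- of_int d * of_int (l - l') / of_int p) / (of_nat N)\<^sup>2)"
    by (rule sum_rotate3)
  also have "\<dots> = (\<Sum>l\<in>L. \<Sum>l'\<in>L. dmask D (of_int (l - l') / of_int p) * ee (- of_int d * of_int (l - l') / of_int p) / of_nat N)"
    using N by (intro sum.cong refl) (simp add: dmask_def sum_distrib_right sum_divide_distrib power2_eq_square N_def[symmetric])
  also have "\<dots> = (\<Sum>l\<in>L. \<Sum>l'\<in>L. if l = l' then 1 / of_nat N else 0)"
    using hadamard_row[OF had] fin dD dmask_0[OF fin(1)]
    by (intro sum.cong refl) auto
  also have "\<dots> = 1" using fin N by simp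
  finally have GG: "(\<Sum>c\<in>D. G c * cnj (G c)) = 1" .
  \<comment> \<open>The squared distance of \<open>G\<close> from the unit vector at
    \<open>d\<close> is \<open>1 - 2 Re (G d)\<close> plus the squared norm of \<open>G\<close>,
    that is 0.\<close>
  define H where "H = (\<lambda>c. (if c = d then 1 else 0) - G c)"
  have "(\<Sum>c\<in>D. H c * cnj (H c)) = (\<Sum>c\<in>D. (if c = d then 1 - G c - cnj (G c) else 0) + G c * cnj (G c))"
    by (intro sum.cong refl) (simp add: H_def algebra_simps)
  also have "\<dots> = 0" using GG Gd dD fin by (simp add: sum.distrib)
  finally have "(\<Sum>c\<in>D. complex_of_real ((norm (H c))\<^sup>2)) = 0"
    by (simp add: complex_norm_square del: of_real_power)
  then have "(\<Sum>c\<in>D. (norm (H c))\<^sup>2) = 0"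
    by (metis of_real_sum of_real_eq_0_iff)
  then have "H d' = 0"
    using fin dD by (simp add: sum_nonneg_eq_0_iff)
  then show ?thesis using N by (auto simp: H_def G_def N_def split: if_splits)
qed

text \<open>The summands are the entries of the image of the unit vector
  \<open>ee (c * x / p) / sqrt N\<close>, indexed by \<open>c\<close> in \<open>D\<close>, under the
  unitary matrix; orthogonality of the columns preserves its norm.\<close>

lemma hadamard_parseval:
  assumes had: "hadamard_triple p D L" and ne: "D \<noteq> {}"
  shows "(\<Sum>l\<in>L. (norm (dmask D ((x + of_int l) / of_int p)))\<^sup>2) = 1"
proof -
  define N where "N = card D"
  have fin: "finite D" "finite L" "card L = N"
    using had by (auto simp: hadamard_triple_def N_def)
  have N: "N > 0" using ne fin by (auto simp: N_def card_gt_0_iff)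
  have "complex_of_real (\<Sum>l\<in>L. (norm (dmask D ((x + of_int l) / of_int p)))\<^sup>2)
      = (\<Sum>l\<in>L. dmask D ((x + of_int l) / of_int p) * cnj (dmask D ((x + of_int l) / of_int p)))"
    by (simp add: complex_norm_square del: of_real_power)
  also have "\<dots> = (\<Sum>l\<in>L. \<Sum>c\<in>D. \<Sum>d\<in>D. ee (of_int c * ((x + of_int l) / of_int p)) * cnj (ee (of_int d * ((x + of_int l) / of_int p))) / (of_nat N)\<^sup>2)"
    by (simp add: dmask_def sum_product sum_divide_distrib[symmetric] power2_eq_square N_def)
  also have "\<dots> = (\<Sum>l\<in>L. \<Sum>c\<in>D. \<Sum>d\<in>D. ee (of_int (c - d) * of_int l / of_int p) * ee (of_int (c - d) * x / of_int p) / (of_nat N)\<^sup>2)"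
    by (intro sum.cong refl arg_cong2[where f="(/)"])
       (simp add: ee_diff[symmetric] ee_add[symmetric], rule arg_cong[where f=ee], simp add: algebra_simps diff_divide_distrib add_divide_distrib)
  also have "\<dots> = (\<Sum>c\<in>D. \<Sum>d\<in>D. \<Sum>l\<in>L. ee (of_int (c - d) * of_int l / of_int p) * ee (of_int (c - d) * x / of_int p) / (of_nat N)\<^sup>2)"
    by (rule sum_rotate3)
  also have "\<dots> = (\<Sum>c\<in>D. \<Sum>d\<in>D. if d = c then 1 / of_nat N else 0)"
    using hadamard_column[OF had] N
    by (intro sum.cong refl) (simp add: sum_divide_distrib[symmetric] sum_distrib_right[symmetric] N_def[symmetric] power2_eq_square)
  also have "\<dots> = 1" using fin ne by (simp add: N_def)
  finally show ?thesis by (metis of_real_eq_1_iff)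
qed

text \<open>Congruent labels give equal rows, but distinct rows are orthogonal. Thus
  \<open>L\<close> is a set of residues, and sums over \<open>L\<close> are bounded by sums over all
  children.\<close>

lemma hadamard_inj_mod:
  assumes had: "hadamard_triple p D L" and "D \<noteq> {}"
  shows "inj_on (\<lambda>l. l mod p) L"
proof (rule inj_onI, rule ccontr)
  fix l l' assume l: "l \<in> L" "l' \<in> L" "l mod p = l' mod p" "l \<noteq> l'"
  then obtain k where "l - l' = p * k" by (metis mod_eq_dvd_iff dvdE)
  moreover have "p > 1" using had by (simp add: hadamard_triple_def)
  ultimately have "of_int (l - l') / of_int p = 0 + real_of_int k" by simp
  then have "dmask D (of_int (l - l') / of_int p) = dmask D 0"
    by (simp only: dmask_add_int)
  then show False
    using hadamard_row[OF had l(1,2,4)] dmask_0[of D] assms by (simp add: hadamard_triple_def)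
qed

lemma dmask_mod:
  assumes "p > 1"
  shows "dmask D ((x + of_int (l mod p)) / of_int p) = dmask D ((x + of_int l) / of_int p)"
proof -
  have "real_of_int l = of_int (l mod p) + of_int p * of_int (l div p)"
    by (metis mod_mult_div_eq of_int_add of_int_mult)
  then have "(x + of_int l) / of_int p = (x + of_int (l mod p)) / of_int p + of_int (l div p)"
    using assms by (simp add: field_simps)
  then show ?thesis by (simp only: dmask_add_int)
qed

text \<open>Each column is multiplied by a unimodular number. This serves to put 0 into every
  \<open>L\<close>, which makes the frequency sets increase.\<close>

lemma hadamard_translate:
  assumes "hadamard_triple p D L"
  shows "hadamard_triple p D ((\<lambda>l. l - c) ` L)"
proof -
  have e: "cis (2 * pi * of_int d * (of_int l1 - of_int c) / of_int p) * cnj (cis (2 * pi * of_int d * (of_int l2 - of_int c) / of_int p))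
     = cis (2 * pi * of_int d * of_int l1 / of_int p) * cnj (cis (2 * pi * of_int d * of_int l2 / of_int p))" for d l1 l2
    by (simp add: cis_cnj cis_mult) (simp add: algebra_simps diff_divide_distrib)
  have "card ((\<lambda>l. l - c) ` L) = card L"
    by (intro card_image inj_onI) simp
  then show ?thesis
    using assms unfolding hadamard_triple_def by (auto simp: mult.assoc[where 'a=complex] e)
qed

section \<open>Interpolation by exponentials\<close>

text \<open>The coefficients are the Lagrange basis polynomials of the nodes, evaluated at 0, so the
  error vanishes to order \<open>k\<close> at \<open>t = 0\<close>. Adding a node: after
  multiplication by the inverse exponential of the new node, the derivative of the error is a
  bounded multiple of the old error.\<close>

lemma exponential_interpolation:
  fixes \<delta> :: real
  assumes "\<delta> > 0"
  shows "\<exists>C>0. \<forall>S. finite S \<and> card S = k \<and> S \<subseteq> {0<..1} \<and> (\<forall>x\<in>S. \<forall>y\<in>S. x \<noteq> y \<longrightarrow> \<delta> \<le> \<bar>x - y\<bar>) \<longrightarrow>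
    (\<exists>c. (\<forall>y\<in>S. norm (c y) \<le> C) \<and> (\<forall>t\<ge>0. norm (1 - (\<Sum>y\<in>S. c y * ee (t * y))) \<le> (2 * pi * t) ^ k / fact k))"
proof (induction k)
  case 0
  have "\<exists>c. (\<forall>y\<in>S. norm (c y) \<le> 1) \<and> (\<forall>t\<ge>0. norm (1 - (\<Sum>y\<in>S. c y * ee (t * y))) \<le> (2 * pi * t) ^ 0 / fact 0)"
    if "finite S" "card S = 0" for S
    using that by simp
  then show ?case by (intro exI[of _ 1]) auto
next
  case (Suc k)
  then obtain C where C: "C > 0" and IH: "\<forall>S. finite S \<and> card S = k \<and> S \<subseteq> {0<..1} \<and> (\<forall>x\<in>S. \<forall>y\<in>S. x \<noteq> y \<longrightarrow> \<delta> \<le> \<bar>x - y\<bar>) \<longrightarrow>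
    (\<exists>c. (\<forall>y\<in>S. norm (c y) \<le> C) \<and> (\<forall>t\<ge>0. norm (1 - (\<Sum>y\<in>S. c y * ee (t * y))) \<le> (2 * pi * t) ^ k / fact k))"
    by (elim exE conjE) (rule that)
  define C' where "C' = 1 + (of_nat k + 1) * C / \<delta>"
  have C': "C' > 0" "C / \<delta> \<le> C'" "1 + of_nat k * (C / \<delta>) \<le> C'"
  proof -
    have "C / \<delta> > 0" using C assms by simp
    then have "of_nat k * (C / \<delta>) \<ge> 0" by (intro mult_nonneg_nonneg) auto
    moreover have "C' = 1 + of_nat k * (C / \<delta>) + C / \<delta>"
      by (simp add: C'_def distrib_right add_divide_distrib)
    ultimately show "C' > 0" "C / \<delta> \<le> C'" "1 + of_nat k * (C / \<delta>) \<le> C'"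
      using \<open>C / \<delta> > 0\<close> by linarith+
  qed
  show ?case
  proof (intro exI[of _ C'] conjI C' allI impI)
    fix S assume S: "finite S \<and> card S = Suc k \<and> S \<subseteq> {0<..1} \<and> (\<forall>x\<in>S. \<forall>y\<in>S. x \<noteq> y \<longrightarrow> \<delta> \<le> \<bar>x - y\<bar>)"
    then obtain y where y: "y \<in> S" by fastforce
    define S' where "S' = S - {y}"
    have S': "finite S'" "card S' = k" "S' \<subseteq> {0<..1}" "\<And>x y. x \<in> S' \<Longrightarrow> y \<in> S' \<Longrightarrow> x \<noteq> y \<Longrightarrow> \<delta> \<le> \<bar>x - y\<bar>"
      and SS: "S = insert y S'" "y \<notin> S'" and y01: "0 < y" "y \<le> 1"
      and sep: "\<And>z. z \<in> S' \<Longrightarrow> \<delta> \<le> \<bar>y - z\<bar>"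
      using S y by (auto simp: S'_def)
    obtain c where c: "\<And>z. z \<in> S' \<Longrightarrow> norm (c z) \<le> C"
      and cb: "\<And>t. t \<ge> 0 \<Longrightarrow> norm (1 - (\<Sum>z\<in>S'. c z * ee (t * z))) \<le> (2 * pi * t) ^ k / fact k"
      using IH[THEN spec, THEN mp, of S'] S' by blast
    \<comment> \<open>Each old coefficient gains the Lagrange factor of the new node
      \<open>y\<close>; the coefficient at \<open>y\<close> makes the total 1, hence
      \<open>F 0 = 0\<close>.\<close>
    define c' where "c' = (\<lambda>z. if z = y then 1 - (\<Sum>z\<in>S'. c z * of_real (y / (y - z))) else c z * of_real (y / (y - z)))"
    have quot: "norm (c z * of_real (y / (y - z))) \<le> C / \<delta>" if "z \<in> S'" for z
    proof -
      have "\<bar>y / (y - z)\<bar> \<le> 1 / \<delta>"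
        using sep[OF that] y01 assms by (simp add: abs_divide frac_le)
      then have "norm (c z) * \<bar>y / (y - z)\<bar> \<le> C * (1 / \<delta>)"
        using c[OF that] C by (intro mult_mono) auto
      then show ?thesis by (simp only: norm_mult norm_of_real) simp
    qed
    have "norm (1 - (\<Sum>z\<in>S'. c z * of_real (y / (y - z)))) \<le> 1 + of_nat k * (C / \<delta>)"
    proof -
      have "norm (\<Sum>z\<in>S'. c z * of_real (y / (y - z))) \<le> of_nat (card S') * (C / \<delta>)"
        by (rule sum_norm_bound) (use quot in auto)
      then show ?thesis
        using S' by (intro order_trans[OF norm_triangle_ineq4]) auto
    qed
    then have c'C: "\<forall>z\<in>S. norm (c' z) \<le> C'"
      using C' by (auto simp: c'_def SS(1) intro: order_trans dest!: quot)
    define E where "E = (\<lambda>t. 1 - (\<Sum>z\<in>S. c' z * ee (t * z)))"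
    \<comment> \<open>Multiplication by \<open>ee (- y * t)\<close> keeps the modulus and makes the
      term of \<open>y\<close> constant, so that differentiation removes it.\<close>
    define F where "F = (\<lambda>t. ee (- y * t) - (\<Sum>z\<in>S'. c' z * ee ((z - y) * t)) - c' y)"
    have EF: "norm (E t) = norm (F t)" for t
    proof -
      have *: "(\<Sum>z\<in>S'. c' z * ee ((z - y) * t)) = ee (- y * t) * (\<Sum>z\<in>S'. c' z * ee (t * z))"
        unfolding sum_distrib_left
        by (intro sum.cong refl) (simp add: ee_add[symmetric] algebra_simps)
      have "ee (- y * t) * ee (t * y) = 1"
        by (simp add: ee_add[symmetric])
      then have "ee (- y * t) * E t = F t"
        unfolding E_def F_def * SS(1) using S' SS(2) by (simp add: algebra_simps)
      then show ?thesis by (metis norm_ee norm_mult mult_1)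
    qed
    define F' where "F' = (\<lambda>t. (2 * pi * - y) *\<^sub>R (\<i> * ee (- y * t)) - (\<Sum>z\<in>S'. c' z * ((2 * pi * (z - y)) *\<^sub>R (\<i> * ee ((z - y) * t)))))"
    have deriv: "(F has_vector_derivative F' t) (at t within A)" for t A
    proof -
      have "((\<lambda>t. ee (- y * t) - (\<Sum>z\<in>S'. c' z * ee ((z - y) * t)) - c' y) has_vector_derivative
        (2 * pi * - y) *\<^sub>R (\<i> * ee (- y * t)) - (\<Sum>z\<in>S'. c' z * ((2 * pi * (z - y)) *\<^sub>R (\<i> * ee ((z - y) * t)))) - 0) (at t within A)"
        by (rule has_vector_derivative_diff has_vector_derivative_sum has_vector_derivative_mult_right
            has_vector_derivative_ee has_vector_derivative_const)+
      then show ?thesis by (simp only: F_def F'_def diff_zero)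
    qed
    have F': "norm (F' t) \<le> 2 * pi * ((2 * pi * t) ^ k / fact k)" if "t \<ge> 0" for t
    proof -
      \<comment> \<open>The factor \<open>z - y\<close> from differentiation cancels the Lagrange
        denominator up to sign and restores the old coefficient.\<close>
      have "c' z * ((2 * pi * (z - y)) *\<^sub>R (\<i> * ee ((z - y) * t))) =
         (2 * pi * - y) *\<^sub>R (\<i> * ee (- y * t)) * (c z * ee (t * z))" if "z \<in> S'" for z
      proof -
        have "z \<noteq> y" using that SS by auto
        then have "complex_of_real (y - z) \<noteq> 0" by (simp del: of_real_diff)
        then have 1: "of_real (y / (y - z)) * of_real (z - y) = complex_of_real (- y)"
          by (simp add: of_real_mult[symmetric] del: of_real_mult of_real_minus) (simp add: field_simps \<open>z \<noteq> y\<close>)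
        have 2: "ee ((z - y) * t) = ee (- y * t) * ee (t * z)"
          by (simp add: ee_add[symmetric] algebra_simps)
        have "c' z * ((2 * pi * (z - y)) *\<^sub>R (\<i> * ee ((z - y) * t))) =
           c z * (of_real (y / (y - z)) * of_real (z - y)) * (of_real (2 * pi)) * \<i> * ee ((z - y) * t)"
          using \<open>z \<noteq> y\<close> by (simp add: c'_def scaleR_conv_of_real)
        then show ?thesis unfolding 1 2 by (simp add: scaleR_conv_of_real)
      qed
      then have "F' t = (2 * pi * - y) *\<^sub>R (\<i> * ee (- y * t)) * (1 - (\<Sum>z\<in>S'. c z * ee (t * z)))"
        by (simp add: F'_def right_diff_distrib sum_distrib_left)
      then have "norm (F' t) = 2 * pi * y * norm (1 - (\<Sum>z\<in>S'. c z * ee (t * z)))"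
        using y01 by (simp add: norm_mult)
      also have "\<dots> \<le> 2 * pi * 1 * ((2 * pi * t) ^ k / fact k)"
        using y01 cb[OF that] by (intro mult_mono) auto
      finally show ?thesis by simp
    qed
    have "norm (E t) \<le> (2 * pi * t) ^ Suc k / fact (Suc k)" if "t \<ge> 0" for t
    proof (cases "t = 0")
      case True
      have "(\<Sum>z\<in>S'. c' z) = (\<Sum>z\<in>S'. c z * of_real (y / (y - z)))"
        using SS by (intro sum.cong) (auto simp: c'_def)
      then have "F 0 = 0" by (simp add: F_def c'_def)
      then show ?thesis using EF True by simp
    next
      case False
      have "(\<Sum>z\<in>S'. c' z) = (\<Sum>z\<in>S'. c z * of_real (y / (y - z)))"
        using SS by (intro sum.cong) (auto simp: c'_def)
      then have F0: "F 0 = 0" by (simp add: F_def c'_def)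
      define \<phi> where "\<phi> = (\<lambda>t::real. (2 * pi * t) ^ Suc k / fact (Suc k))"
      have d\<phi>: "(\<phi> has_vector_derivative 2 * pi * ((2 * pi * t) ^ k / fact k)) (at t within A)" for t A
      proof -
        have *: "fact (Suc k) = (1 + real k) * fact k" "1 + real k \<noteq> 0"
          by auto
        have "((\<lambda>t. (2 * pi * t) ^ Suc k / fact (Suc k)) has_real_derivative
            (1 + real k) * (2 * pi * (2 * pi * t) ^ k) / fact (Suc k)) (at t within A)"
          by (intro DERIV_cdivide DERIV_power_Suc DERIV_cmult_Id)
        also have "(1 + real k) * (2 * pi * (2 * pi * t) ^ k) / fact (Suc k) = 2 * pi * ((2 * pi * t) ^ k / fact k)"
          unfolding *(1) mult_divide_mult_cancel_left[OF *(2)] by (rule times_divide_eq_right[symmetric])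
        finally show ?thesis
          unfolding \<phi>_def has_real_derivative_iff_has_vector_derivative[symmetric] .
      qed
      have "norm (F t - F 0) \<le> \<phi> t - \<phi> 0"
      proof (rule differentiable_bound_general)
        show "0 < t" using that False by simp
        show "continuous_on {0..t} F"
          using deriv by (meson continuous_on_vector_derivative)
        show "continuous_on {0..t} \<phi>"
          using d\<phi> by (meson continuous_on_vector_derivative)
      qed (use deriv d\<phi> F' in auto)
      then show ?thesis using F0 EF by (simp add: \<phi>_def)
    qed
    then show "\<exists>c. (\<forall>y\<in>S. norm (c y) \<le> C') \<and> (\<forall>t\<ge>0. norm (1 - (\<Sum>y\<in>S. c y * ee (t * y))) \<le> (2 * pi * t) ^ Suc k / fact (Suc k))"
      using c'C unfolding E_def by blast
  qed
qed

text \<open>The closed convex hull of the exponentials with frequencies in \<open>[0, R]\<close>, described by its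
  supporting functionals so that it is visibly closed under pointwise limits.\<close>
definition exp_hull :: "real \<Rightarrow> (real \<Rightarrow> complex) \<Rightarrow> bool" where
  "exp_hull R g \<longleftrightarrow> (\<forall>S c b. finite S \<longrightarrow> (\<forall>t\<in>{0..R}. norm (\<Sum>y\<in>S. c y * ee (t * y)) \<le> b) \<longrightarrow>
     norm (\<Sum>y\<in>S. c y * g y) \<le> b)"

lemma exp_hullD:
  assumes "exp_hull R g" "finite S" "\<And>t. 0 \<le> t \<Longrightarrow> t \<le> R \<Longrightarrow> norm (\<Sum>y\<in>S. c y * ee (t * y)) \<le> b"
  shows "norm (\<Sum>y\<in>S. c y * g y) \<le> b"
  using assms unfolding exp_hull_def by (metis atLeastAtMost_iff)

lemma exp_hull_1: "R \<ge> 0 \<Longrightarrow> exp_hull R (\<lambda>_. 1)"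
  unfolding exp_hull_def
  by (intro allI impI) (drule bspec[of _ _ 0], auto)

lemma exp_hull_mono: "exp_hull R g \<Longrightarrow> R \<le> R' \<Longrightarrow> exp_hull R' g"
  unfolding exp_hull_def by (meson atLeastAtMost_iff order_trans)

text \<open>Multiplying by the mask averages over translations of all frequencies by
  \<open>of_int d * s\<close>: supports add under convolution.\<close>

lemma exp_hull_mult_dmask:
  assumes g: "exp_hull R g" and D: "finite D" "D \<noteq> {}"
    and bd: "\<And>d. d \<in> D \<Longrightarrow> 0 \<le> of_int d * s \<and> of_int d * s \<le> R'"
  shows "exp_hull (R + R') (\<lambda>y. g y * dmask D (s * y))"
  unfolding exp_hull_def
proof (intro allI impI)
  fix S c and b :: real
  assume S: "finite S" and b: "\<forall>t\<in>{0..R + R'}. norm (\<Sum>y\<in>S. c y * ee (t * y)) \<le> b"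
  have d: "norm (\<Sum>y\<in>S. c y * ee (of_int d * s * y) * g y) \<le> b" if "d \<in> D" for d
  proof (rule exp_hullD[OF g S])
    fix t assume t: "0 \<le> t" "t \<le> R"
    have "(\<Sum>y\<in>S. c y * ee (of_int d * s * y) * ee (t * y)) = (\<Sum>y\<in>S. c y * ee ((t + of_int d * s) * y))"
      by (intro sum.cong refl) (simp add: ee_add[symmetric] algebra_simps)
    then show "norm (\<Sum>y\<in>S. c y * ee (of_int d * s * y) * ee (t * y)) \<le> b"
      using b t bd[OF that] by auto
  qed
  have "(\<Sum>y\<in>S. c y * (g y * dmask D (s * y))) = (\<Sum>y\<in>S. \<Sum>d\<in>D. c y * ee (of_int d * s * y) * g y / of_nat (card D))"
    by (simp add: dmask_def sum_divide_distrib sum_distrib_left mult_ac)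
  also have "\<dots> = (\<Sum>d\<in>D. \<Sum>y\<in>S. c y * ee (of_int d * s * y) * g y) / of_nat (card D)"
    by (subst sum.swap) (simp add: sum_divide_distrib)
  finally have "norm (\<Sum>y\<in>S. c y * (g y * dmask D (s * y))) = norm (\<Sum>d\<in>D. \<Sum>y\<in>S. c y * ee (of_int d * s * y) * g y) / of_nat (card D)"
    by (simp add: norm_divide)
  also have "\<dots> \<le> of_nat (card D) * b / of_nat (card D)"
    by (intro divide_right_mono sum_norm_bound d) auto
  finally show "norm (\<Sum>y\<in>S. c y * (g y * dmask D (s * y))) \<le> b"
    using D by (simp add: card_gt_0_iff)
qed

lemma exp_hull_limit:
  assumes "\<And>j. exp_hull R (f j)" "\<And>y. (\<lambda>j. f j y) \<longlonglongrightarrow> g y"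
  shows "exp_hull R g"
  unfolding exp_hull_def
proof (intro allI impI)
  fix S c and b :: real
  assume "finite S" and b: "\<forall>t\<in>{0..R}. norm (\<Sum>y\<in>S. c y * ee (t * y)) \<le> b"
  then have "norm (\<Sum>y\<in>S. c y * f j y) \<le> b" for j
    using exp_hullD[OF assms(1)] by auto
  moreover have "(\<lambda>j. norm (\<Sum>y\<in>S. c y * f j y)) \<longlonglongrightarrow> norm (\<Sum>y\<in>S. c y * g y)"
    by (intro tendsto_intros assms)
  ultimately show "norm (\<Sum>y\<in>S. c y * g y) \<le> b"
    by (intro LIMSEQ_le_const2) auto
qed

lemma exp_hull_lipschitz:
  assumes "exp_hull R g"
  shows "norm (g x - g y) \<le> 2 * pi * R * \<bar>x - y\<bar>"
proof (cases "x = y")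
  case False
  have "norm (\<Sum>z\<in>{x, y}. (if z = x then 1 else - 1) * g z) \<le> 2 * pi * R * \<bar>x - y\<bar>"
  proof (rule exp_hullD[OF assms])
    fix t assume t: "0 \<le> t" "t \<le> R"
    have "norm (ee (t * x) - ee (t * y)) \<le> 2 * pi * \<bar>t * x - t * y\<bar>"
      by (rule norm_ee_diff_le)
    also have "\<dots> = 2 * pi * t * \<bar>x - y\<bar>"
      using t by (simp add: right_diff_distrib[symmetric] abs_mult)
    also have "\<dots> \<le> 2 * pi * R * \<bar>x - y\<bar>"
      using t by (intro mult_mono) auto
    finally show "norm (\<Sum>z\<in>{x, y}. (if z = x then 1 else - 1) * ee (t * z)) \<le> 2 * pi * R * \<bar>x - y\<bar>"
      using False by simp
  qed simp
  then show ?thesis using False by simp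
qed simp

text \<open>The functional with coefficient 1 at 0 and \<open>- c y\<close> on \<open>S\<close> is
  at most 1/2 on exponentials with frequency up to \<open>R\<close>, hence on \<open>g\<close>. If
  \<open>g\<close> were tiny on \<open>S\<close>, the functional would be close to
  \<open>g 0 = 1\<close>.\<close>

lemma exp_hull_large_value:
  fixes \<delta> :: real
  assumes R: "R \<ge> 0" and k: "(2 * pi * R) ^ k / fact k \<le> 1 / 2" and \<delta>: "\<delta> > 0"
  shows "\<exists>\<epsilon>>0. \<forall>g S. exp_hull R g \<and> g 0 = 1 \<and> finite S \<and> card S = k \<and> S \<subseteq> {0..1} \<and>
    (\<forall>x\<in>S. \<forall>y\<in>S. x \<noteq> y \<longrightarrow> \<delta> \<le> \<bar>x - y\<bar>) \<longrightarrow> (\<exists>y\<in>S. norm (g y) \<ge> \<epsilon>)"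
proof -
  obtain C where C: "C > 0" and main: "\<forall>S. finite S \<and> card S = k \<and> S \<subseteq> {0<..1} \<and> (\<forall>x\<in>S. \<forall>y\<in>S. x \<noteq> y \<longrightarrow> \<delta> \<le> \<bar>x - y\<bar>) \<longrightarrow>
    (\<exists>c. (\<forall>y\<in>S. norm (c y) \<le> C) \<and> (\<forall>t\<ge>0. norm (1 - (\<Sum>y\<in>S. c y * ee (t * y))) \<le> (2 * pi * t) ^ k / fact k))"
    using exponential_interpolation[OF \<delta>, of k] by (elim exE conjE) (rule that)
  \<comment> \<open>The second entry yields \<open>k * C * \<epsilon> \<le> 1 / 4\<close>. The entry
    1 keeps 0, where \<open>g\<close> is 1, out of a set of small values, since interpolation needs
    positive nodes.\<close>
  define \<epsilon> where "\<epsilon> = min 1 (1 / (4 * (of_nat k + 1) * C))"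
  have "\<exists>y\<in>S. norm (g y) \<ge> \<epsilon>"
    if g: "exp_hull R g" "g 0 = 1" and S: "finite S" "card S = k" "S \<subseteq> {0..1}"
      "\<And>x y. x \<in> S \<Longrightarrow> y \<in> S \<Longrightarrow> x \<noteq> y \<Longrightarrow> \<delta> \<le> \<bar>x - y\<bar>" for g S
  proof (rule ccontr)
    assume neg: "\<not> (\<exists>y\<in>S. norm (g y) \<ge> \<epsilon>)"
    then have "0 \<notin> S" using g by (auto simp: \<epsilon>_def)
    then have S0: "S \<subseteq> {0<..1}" using S(3) by (force simp: less_le)
    obtain c where c: "\<And>y. y \<in> S \<Longrightarrow> norm (c y) \<le> C"
      and cb: "\<And>t. t \<ge> 0 \<Longrightarrow> norm (1 - (\<Sum>y\<in>S. c y * ee (t * y))) \<le> (2 * pi * t) ^ k / fact k"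
      using main[THEN spec, THEN mp, of S] S S0 by blast
    define c' where "c' = (\<lambda>y. if y = 0 then 1 else - c y)"
    have sum_c': "(\<Sum>y\<in>insert 0 S. c' y * h y) = h 0 - (\<Sum>y\<in>S. c y * h y)" for h
    proof -
      have "(\<Sum>y\<in>S. c' y * h y) = - (\<Sum>y\<in>S. c y * h y)"
        unfolding sum_negf[symmetric] using \<open>0 \<notin> S\<close> by (intro sum.cong refl) (auto simp: c'_def)
      then show ?thesis using S(1) \<open>0 \<notin> S\<close> by (simp add: c'_def)
    qed
    have "norm (\<Sum>y\<in>insert 0 S. c' y * g y) \<le> 1 / 2"
    proof (rule exp_hullD[OF g(1)])
      fix t assume t: "0 \<le> t" "t \<le> R"
      have "norm (1 - (\<Sum>y\<in>S. c y * ee (t * y))) \<le> (2 * pi * R) ^ k / fact k"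
        using t by (intro order_trans[OF cb] divide_right_mono power_mono mult_left_mono) auto
      then show "norm (\<Sum>y\<in>insert 0 S. c' y * ee (t * y)) \<le> 1 / 2"
        unfolding sum_c' mult_zero_right ee_0 using k by linarith
    qed (use S in simp)
    then have "norm (1 - (\<Sum>y\<in>S. c y * g y)) \<le> 1 / 2"
      unfolding sum_c' g(2) .
    moreover have "norm (\<Sum>y\<in>S. c y * g y) \<le> of_nat k * (C * \<epsilon>)"
    proof -
      have "norm (c y * g y) \<le> C * \<epsilon>" if "y \<in> S" for y
        unfolding norm_mult using c[OF that] neg that C by (intro mult_mono) (auto simp: not_le intro: less_imp_le)
      then show ?thesis using sum_norm_bound[of S "\<lambda>y. c y * g y" "C * \<epsilon>"] S by simp
    qed
    moreover have "of_nat k * (C * \<epsilon>) \<le> 1 / 4"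
    proof -
      have "of_nat k * (C * \<epsilon>) \<le> of_nat k * (C * (1 / (4 * (of_nat k + 1) * C)))"
        using C by (intro mult_left_mono) (auto simp: \<epsilon>_def)
      also have "\<dots> = of_nat k / (4 * (of_nat k + 1))" using C by simp
      also have "\<dots> \<le> 1 / 4" by (simp add: field_simps)
      finally show ?thesis .
    qed
    moreover have "1 \<le> norm (1 - (\<Sum>y\<in>S. c y * g y)) + norm (\<Sum>y\<in>S. c y * g y)"
      using norm_triangle_ineq[of "1 - (\<Sum>y\<in>S. c y * g y)" "\<Sum>y\<in>S. c y * g y"] by simp
    ultimately show False by simp
  qed
  moreover have "\<epsilon> > 0" using C by (simp add: \<epsilon>_def)
  ultimately show ?thesis by (intro exI[of _ \<epsilon>]) auto
qed

lemma ex_power_div_fact_le_half: "\<exists>k\<ge>1. (x::real) ^ k / fact k \<le> 1 / 2"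
proof -
  have "(\<lambda>k. x ^ k / fact k) \<longlonglongrightarrow> 0"
    using summable_LIMSEQ_zero[OF summable_exp[of x]] by (simp add: field_simps)
  then have "eventually (\<lambda>k. x ^ k / fact k < 1 / 2) sequentially"
    by (rule order_tendstoD) simp
  then have "eventually (\<lambda>k. x ^ k / fact k < 1 / 2 \<and> k \<ge> 1) sequentially"
    using eventually_ge_at_top[of 1] by eventually_elim simp
  then show ?thesis by (auto simp: eventually_sequentially intro: less_imp_le)
qed

section \<open>Infinite convolutions\<close>

lemma fourier_eq_ee: "fourier M \<xi> = (CLINT x|M. ee (x * \<xi>))"
  by (simp add: fourier_def ee_def mult.assoc)

lemma fourier_eq_char: "fourier M \<xi> = char M (2 * pi * \<xi>)"
  by (simp add: fourier_def char_def cis_conv_exp mult_ac)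

lemma (in real_distribution) integrable_ee [simp]:
  assumes "f \<in> borel_measurable M"
  shows "integrable M (\<lambda>x. ee (f x))"
  by (rule integrable_const_bound[of _ 1]) (use assms in auto)

lemma real_distribution_delta:
  "real_distribution (delta A)"
  unfolding delta_def by (intro prob_space.real_distribution_distr measure_pmf.prob_space_axioms) simp

lemma AE_delta:
  assumes "finite A" "A \<noteq> {}"
  shows "AE x in delta A. x \<in> A"
  using assms unfolding delta_def
  by (subst AE_distr_iff) (auto simp: AE_measure_pmf_iff finite_imp_closed)

lemma fourier_delta:
  assumes "finite D" "D \<noteq> {}" "P \<noteq> 0"
  shows "fourier (delta ((\<lambda>d. of_int d / P) ` D)) \<xi> = dmask D (\<xi> / P)"
proof -
  let ?A = "(\<lambda>d. of_int d / P) ` D"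
  have inj: "inj_on (\<lambda>d. of_int d / P) D"
    using assms(3) by (auto intro!: inj_onI)
  have "fourier (delta ?A) \<xi> = (\<integral>x. ee (x * \<xi>) \<partial>measure_pmf (pmf_of_set ?A))"
    unfolding fourier_eq_ee delta_def by (subst integral_distr) auto
  also have "\<dots> = (\<Sum>a\<in>?A. pmf (pmf_of_set ?A) a *\<^sub>R ee (a * \<xi>))"
    by (rule integral_measure_pmf) (use assms in auto)
  also have "\<dots> = (\<Sum>a\<in>?A. ee (a * \<xi>) / of_nat (card D))"
    using assms card_image[OF inj]
    by (intro sum.cong refl) (auto simp: pmf_of_set indicator_def scaleR_conv_of_real divide_inverse mult.commute)
  also have "\<dots> = (\<Sum>d\<in>D. ee (of_int d / P * \<xi>) / of_nat (card D))"
    by (subst sum.reindex[OF inj]) simp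
  finally show ?thesis by (simp add: dmask_def sum_divide_distrib)
qed

lemma real_distribution_convolution:
  assumes "real_distribution M" "real_distribution N"
  shows "real_distribution (M \<star> N)"
proof -
  interpret M: real_distribution M by fact
  interpret N: real_distribution N by fact
  interpret P: pair_prob_space M N ..
  show ?thesis
    unfolding convolution_def by (intro P.real_distribution_distr) simp
qed

lemma fourier_convolution:
  assumes "real_distribution M" "real_distribution N"
  shows "fourier (M \<star> N) \<xi> = fourier M \<xi> * fourier N \<xi>"
proof -
  interpret M: real_distribution M by fact
  interpret N: real_distribution N by fact
  interpret P: pair_prob_space M N ..
  have int: "integrable (M \<Otimes>\<^sub>M N) (\<lambda>(x, y). ee (x * \<xi>) * ee (y * \<xi>))"
    by (rule P.integrable_const_bound[of _ 1]) (auto simp: norm_mult)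
  have "fourier (M \<star> N) \<xi> = (\<integral>z. ee ((case z of (x, y) \<Rightarrow> x + y) * \<xi>) \<partial>(M \<Otimes>\<^sub>M N))"
    unfolding fourier_eq_ee convolution_def by (subst integral_distr) auto
  also have "\<dots> = (\<integral>z. (case z of (x, y) \<Rightarrow> ee (x * \<xi>) * ee (y * \<xi>)) \<partial>(M \<Otimes>\<^sub>M N))"
    by (intro Bochner_Integration.integral_cong refl) (auto simp: ee_add distrib_right)
  also have "\<dots> = (\<integral>x. (\<integral>y. ee (x * \<xi>) * ee (y * \<xi>) \<partial>N) \<partial>M)"
    by (rule P.integral_fst[OF int, symmetric])
  also have "\<dots> = fourier M \<xi> * fourier N \<xi>"
    by (simp add: fourier_eq_ee)
  finally show ?thesis .
qed

lemma AE_convolution: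
  assumes "real_distribution M" "real_distribution N"
    and M: "AE x in M. 0 \<le> x \<and> x \<le> a" and N: "AE x in N. 0 \<le> x \<and> x \<le> b"
  shows "AE x in M \<star> N. 0 \<le> x \<and> x \<le> a + b"
proof -
  interpret M: real_distribution M by fact
  interpret N: real_distribution N by fact
  interpret P: pair_prob_space M N ..
  have "AE x in M. AE y in N. 0 \<le> x + y \<and> x + y \<le> a + b"
    using M by eventually_elim (use N in eventually_elim, auto)
  then have "AE z in M \<Otimes>\<^sub>M N. 0 \<le> fst z + snd z \<and> fst z + snd z \<le> a + b"
  proof (intro P.AE_pair_measure)
    have "(\<lambda>z. fst z + snd z) \<in> borel_measurable (M \<Otimes>\<^sub>M N)"
      by simp
    then have "(\<lambda>z. fst z + snd z) -` {0..a + b} \<inter> space (M \<Otimes>\<^sub>M N) \<in> sets (M \<Otimes>\<^sub>M N)"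
      by (rule measurable_sets) simp
    moreover have "(\<lambda>z. fst z + snd z) -` {0..a + b} \<inter> space (M \<Otimes>\<^sub>M N) =
        {z \<in> space (M \<Otimes>\<^sub>M N). 0 \<le> fst z + snd z \<and> fst z + snd z \<le> a + b}"
      by auto
    ultimately show "{z \<in> space (M \<Otimes>\<^sub>M N). 0 \<le> fst z + snd z \<and> fst z + snd z \<le> a + b} \<in> sets (M \<Otimes>\<^sub>M N)"
      by simp
  qed simp
  then show ?thesis
    unfolding convolution_def by (subst AE_distr_iff) (auto simp: case_prod_beta)
qed

section \<open>Partial convolutions, their weak limits and the limits' Fourier transforms\<close>

locale digit_system =
  fixes p :: "nat \<Rightarrow> int" and D :: "nat \<Rightarrow> int set" and B :: real
  assumes p_gt_1: "n \<ge> 1 \<Longrightarrow> p n > 1"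
    and finD: "n \<ge> 1 \<Longrightarrow> finite (D n)"
    and zeroD: "n \<ge> 1 \<Longrightarrow> 0 \<in> D n"
    and nonneg: "n \<ge> 1 \<Longrightarrow> d \<in> D n \<Longrightarrow> d \<ge> 0"
    and digit_le: "n \<ge> 1 \<Longrightarrow> d \<in> D n \<Longrightarrow> of_int d / of_int (p n) \<le> B"
begin

lemma D_ne: "n \<ge> 1 \<Longrightarrow> D n \<noteq> {}"
  using zeroD by auto

lemma B_nonneg: "B \<ge> 0"
  using digit_le[of 1 0] zeroD[of 1] by simp

definition scale :: "nat \<Rightarrow> nat \<Rightarrow> real" where
  "scale n j = (\<Prod>i\<in>{n+1..n+j}. of_int (p i))"

lemma scale_0 [simp]: "scale n 0 = 1"
  by (simp add: scale_def)

lemma scale_Suc: "scale n (Suc j) = scale n j * of_int (p (Suc (n + j)))"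
  by (simp add: scale_def)

lemma scale_Suc_shift: "scale n (Suc j) = of_int (p (Suc n)) * scale (Suc n) j"
  by (induction j) (simp_all add: scale_Suc)

lemma scale_ge: "scale n j \<ge> 2 ^ j"
proof (induction j)
  case (Suc j)
  have "p (Suc (n + j)) \<ge> 2" using p_gt_1[of "Suc (n + j)"] by simp
  then have "scale n j * of_int (p (Suc (n + j))) \<ge> 2 ^ j * 2"
    using Suc order_trans[OF zero_le_power Suc] by (intro mult_mono) auto
  then show ?case by (simp add: scale_Suc mult.commute)
qed simp

lemma scale_pos: "scale n j > 0"
  using scale_ge[of j n] by (meson less_le_trans zero_less_numeral zero_less_power)

text \<open>The Fourier transform of the first \<open>j\<close> factors after level
  \<open>n\<close>, see \<open>fourier_conv_part\<close>.\<close>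

definition phi :: "nat \<Rightarrow> nat \<Rightarrow> real \<Rightarrow> complex" where
  "phi n j \<xi> = (\<Prod>i<j. dmask (D (Suc (n + i))) (\<xi> / scale n (Suc i)))"

lemma phi_0 [simp]: "phi n 0 \<xi> = 1"
  by (simp add: phi_def)

lemma phi_Suc: "phi n (Suc j) \<xi> = phi n j \<xi> * dmask (D (Suc (n + j))) (\<xi> / scale n (Suc j))"
  by (simp add: phi_def)

lemma phi_Suc_shift:
  "phi n (Suc j) \<xi> = dmask (D (Suc n)) (\<xi> / of_int (p (Suc n))) * phi (Suc n) j (\<xi> / of_int (p (Suc n)))"
  unfolding phi_def by (subst prod.lessThan_Suc_shift) (simp add: scale_Suc_shift scale_Suc)

lemma real_distribution_conv_part: "real_distribution (conv_part p D n j)"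
proof (induction j)
  case 0
  interpret R: prob_space "return borel (0::real)" by (rule prob_space_return) simp
  show ?case by (simp add: real_distribution_def real_distribution_axioms_def R.prob_space_axioms)
qed (simp add: real_distribution_convolution real_distribution_delta)

lemma fourier_conv_part: "fourier (conv_part p D n j) \<xi> = phi n j \<xi>"
proof (induction j)
  case 0
  show ?case by (simp add: fourier_eq_ee integral_return)
next
  case (Suc j)
  have "fourier (delta ((\<lambda>d. of_int d / scale n (Suc j)) ` D (Suc (n + j)))) \<xi> = dmask (D (Suc (n + j))) (\<xi> / scale n (Suc j))"
    using scale_pos[of n "Suc j"] finD D_ne by (intro fourier_delta) auto
  then show ?case
    using Suc by (simp add: fourier_convolution real_distribution_conv_part real_distribution_delta phi_Suc scale_def)
qed

text \<open>A digit over its own base is at most \<open>B\<close>, and the \<open>j\<close>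
  remaining bases are at least 2 each.\<close>

lemma digit_scale_le:
  assumes "d \<in> D (Suc (n + j))"
  shows "0 \<le> of_int d * (1 / scale n (Suc j)) \<and> of_int d * (1 / scale n (Suc j)) \<le> B / 2 ^ j"
proof
  show "0 \<le> of_int d * (1 / scale n (Suc j))"
    using nonneg[OF _ assms] scale_pos[of n "Suc j"] by simp
  have "of_int d * (1 / scale n (Suc j)) = (of_int d / of_int (p (Suc (n + j)))) / scale n j"
    by (simp add: scale_Suc)
  also have "\<dots> \<le> B / scale n j"
    using digit_le[OF _ assms] scale_pos[of n j] by (intro divide_right_mono) auto
  also have "\<dots> \<le> B / 2 ^ j"
    using B_nonneg scale_ge[of j n] by (intro divide_left_mono) (auto simp: scale_pos)
  finally show "of_int d * (1 / scale n (Suc j)) \<le> B / 2 ^ j" .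
qed

lemma geometric_partial_sum: "B * (2 - 2 / 2 ^ j) + B / 2 ^ j = B * (2 - 2 / 2 ^ Suc j)"
  by (simp add: field_simps)

lemma exp_hull_phi_partial: "exp_hull (B * (2 - 2 / 2 ^ j)) (phi n j)"
proof (induction j)
  case 0
  then show ?case by (simp add: phi_def exp_hull_1)
next
  case (Suc j)
  have "exp_hull (B * (2 - 2 / 2 ^ j) + B / 2 ^ j) (\<lambda>y. phi n j y * dmask (D (Suc (n + j))) (1 / scale n (Suc j) * y))"
    by (rule exp_hull_mult_dmask[OF Suc]) (use finD D_ne digit_scale_le in auto)
  then show ?case by (simp add: geometric_partial_sum phi_Suc[abs_def])
qed

lemma exp_hull_phi: "exp_hull (2 * B) (phi n j)"
proof (rule exp_hull_mono[OF exp_hull_phi_partial])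
  show "B * (2 - 2 / 2 ^ j) \<le> 2 * B"
    using B_nonneg by (simp add: algebra_simps)
qed

lemma norm_phi_le_1: "norm (phi n j \<xi>) \<le> 1"
  unfolding phi_def prod_norm[symmetric] by (intro prod_le_1) (auto simp: norm_dmask_le_1)

text \<open>The new mask is a mean of exponentials with frequencies in
  \<open>[0, B / 2 ^ j]\<close>, so the Lipschitz bound applies, starting from its value 1 at
  0.\<close>

lemma norm_phi_Suc_diff: "norm (phi n (Suc j) \<xi> - phi n j \<xi>) \<le> 2 * pi * B * \<bar>\<xi>\<bar> * (1 / 2) ^ j"
proof -
  let ?m = "\<lambda>y. dmask (D (Suc (n + j))) (1 / scale n (Suc j) * y)"
  have "exp_hull (0 + B / 2 ^ j) (\<lambda>y. 1 * ?m y)"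
    by (rule exp_hull_mult_dmask[OF exp_hull_1]) (use finD D_ne digit_scale_le in auto)
  from exp_hull_lipschitz[OF this, of \<xi> 0] have m: "norm (?m \<xi> - 1) \<le> 2 * pi * B * \<bar>\<xi>\<bar> * (1 / 2) ^ j"
    using finD D_ne by (simp add: dmask_0 field_simps)
  have "phi n (Suc j) \<xi> - phi n j \<xi> = phi n j \<xi> * (?m \<xi> - 1)"
    by (simp add: phi_Suc algebra_simps)
  then have "norm (phi n (Suc j) \<xi> - phi n j \<xi>) = norm (phi n j \<xi>) * norm (?m \<xi> - 1)"
    by (simp add: norm_mult)
  also have "\<dots> \<le> 1 * norm (?m \<xi> - 1)"
    by (intro mult_right_mono norm_phi_le_1) simp
  finally show ?thesis using m by simp
qed

lemma convergent_phi: "convergent (\<lambda>j. phi n j \<xi>)"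
proof -
  have "summable (\<lambda>j. phi n (Suc j) \<xi> - phi n j \<xi>)"
    by (rule summable_comparison_test'[where g = "\<lambda>j. 2 * pi * B * \<bar>\<xi>\<bar> * (1 / 2) ^ j"])
       (use norm_phi_Suc_diff in \<open>auto intro!: summable_mult summable_geometric\<close>)
  then have "convergent (\<lambda>m. \<Sum>j<m. phi n (Suc j) \<xi> - phi n j \<xi>)"
    by (simp add: summable_iff_convergent)
  then have "convergent (\<lambda>m. phi n m \<xi> - 1)"
    by (simp only: sum_lessThan_telescope[of "\<lambda>j. phi n j \<xi>"] phi_0)
  then show ?thesis by (simp add: convergent_diff_const_right_iff)
qed

lemma AE_conv_part: "AE x in conv_part p D n j. 0 \<le> x \<and> x \<le> B * (2 - 2 / 2 ^ j)"
proof (induction j)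
  case 0
  show ?case unfolding conv_part.simps by (subst AE_return) auto
next
  case (Suc j)
  let ?N = "delta ((\<lambda>d. of_int d / scale n (Suc j)) ` D (Suc (n + j)))"
  have "AE x in ?N. x \<in> (\<lambda>d. of_int d / scale n (Suc j)) ` D (Suc (n + j))"
    by (rule AE_delta) (use finD D_ne in auto)
  then have "AE x in ?N. 0 \<le> x \<and> x \<le> B / 2 ^ j"
    by eventually_elim (use digit_scale_le in auto)
  from AE_convolution[OF real_distribution_conv_part real_distribution_delta Suc this]
  moreover have "conv_part p D n (Suc j) = (conv_part p D n j \<star> ?N)"
    by (simp add: scale_def)
  ultimately show ?case by (simp only: geometric_partial_sum)
qed

lemma tight_conv_part: "tight (conv_part p D n)"
  unfolding tight_def
proof (intro conjI allI impI real_distribution_conv_part)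
  fix \<epsilon> :: real assume \<epsilon>: "\<epsilon> > 0"
  have "measure (conv_part p D n j) {-1<..2 * B} > 1 - \<epsilon>" for j
  proof -
    interpret real_distribution "conv_part p D n j" by (rule real_distribution_conv_part)
    have "AE x in conv_part p D n j. x \<in> {-1<..2 * B}"
      using AE_conv_part[where n = n and j = j]
    proof eventually_elim
      case (elim x)
      have "B * (2 - 2 / 2 ^ j) \<le> 2 * B"
        using B_nonneg by (simp add: algebra_simps)
      with elim show ?case by auto
    qed
    then have "prob {-1<..2 * B} = 1"
      by (subst prob_eq_1) auto
    with \<epsilon> show ?thesis by simp
  qed
  moreover have "-1 < 2 * B" using B_nonneg by linarith
  ultimately show "\<exists>a b. a < b \<and> (\<forall>j. 1 - \<epsilon> < measure (conv_part p D n j) {a<..b})"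
    by blast
qed

text \<open>This justifies the definite description in \<open>nu\<close>. Tightness gives a limit
  along a subsequence; convergence of all characteristic functions extends it to the whole sequence,
  and Levy's theorem gives uniqueness.\<close>

lemma ex1_nu: "\<exists>!M. real_distribution M \<and> weak_conv_m (conv_part p D n) M"
proof -
  obtain r M where r: "strict_mono (r :: nat \<Rightarrow> nat)" and M: "real_distribution M"
    and w: "weak_conv_m (conv_part p D n \<circ> id \<circ> r) M"
    using tight_imp_convergent_subsubsequence[OF tight_conv_part strict_mono_id] by blast
  have "(\<lambda>j. char (conv_part p D n j) t) \<longlonglongrightarrow> char M t" for t
  proof -
    have t: "char N t = fourier N (t / (2 * pi))" for N
      by (simp add: fourier_eq_char)
    have "convergent (\<lambda>j. char (conv_part p D n j) t)"
      using convergent_phi[of n "t / (2 * pi)"] by (simp add: t fourier_conv_part)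
    then obtain c where c: "(\<lambda>j. char (conv_part p D n j) t) \<longlonglongrightarrow> c"
      by (auto simp: convergent_def)
    have "(\<lambda>j. char ((conv_part p D n \<circ> id \<circ> r) j) t) \<longlonglongrightarrow> char M t"
      by (rule levy_continuity1[OF _ M w]) (simp add: real_distribution_conv_part)
    moreover have "(\<lambda>j. char ((conv_part p D n \<circ> id \<circ> r) j) t) \<longlonglongrightarrow> c"
      using LIMSEQ_subseq_LIMSEQ[OF c r] by (simp add: o_def)
    ultimately show ?thesis using c LIMSEQ_unique by blast
  qed
  then have "weak_conv_m (conv_part p D n) M"
    by (intro levy_continuity real_distribution_conv_part M)
  moreover have "N = M" if N: "real_distribution N" "weak_conv_m (conv_part p D n) N" for N
  proof (rule Levy_uniqueness[OF N(1) M ext])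
    fix t
    show "char N t = char M t"
      using levy_continuity1[OF real_distribution_conv_part N, of t]
        levy_continuity1[OF real_distribution_conv_part M \<open>weak_conv_m (conv_part p D n) M\<close>, of t]
      by (rule LIMSEQ_unique)
  qed
  ultimately show ?thesis using M by blast
qed

lemma nu: "real_distribution (nu p D n)" "weak_conv_m (conv_part p D n) (nu p D n)"
  using theI'[OF ex1_nu] by (simp_all add: nu_def)

definition g :: "nat \<Rightarrow> real \<Rightarrow> complex" where
  "g n = fourier (nu p D n)"

lemma phi_tendsto: "(\<lambda>j. phi n j \<xi>) \<longlonglongrightarrow> g n \<xi>"
  using levy_continuity1[OF real_distribution_conv_part nu, of n "2 * pi * \<xi>"]
  by (simp add: g_def fourier_eq_char[symmetric] fourier_conv_part)

lemma g_0 [simp]: "g n 0 = 1"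
proof -
  have "phi n j 0 = 1" for j
    by (induction j) (simp_all add: phi_Suc dmask_0 finD D_ne)
  then show ?thesis
    using phi_tendsto[of n 0] by (simp add: LIMSEQ_const_iff)
qed

lemma g_Suc: "g n \<xi> = dmask (D (Suc n)) (\<xi> / of_int (p (Suc n))) * g (Suc n) (\<xi> / of_int (p (Suc n)))"
proof (rule LIMSEQ_unique)
  show "(\<lambda>j. phi n (Suc j) \<xi>) \<longlonglongrightarrow> g n \<xi>"
    by (rule LIMSEQ_Suc[OF phi_tendsto])
  show "(\<lambda>j. phi n (Suc j) \<xi>) \<longlonglongrightarrow> dmask (D (Suc n)) (\<xi> / of_int (p (Suc n))) * g (Suc n) (\<xi> / of_int (p (Suc n)))"
    unfolding phi_Suc_shift by (intro tendsto_intros phi_tendsto)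
qed

lemma exp_hull_g: "exp_hull (2 * B) (g n)"
  by (rule exp_hull_limit[OF exp_hull_phi phi_tendsto])

lemma g_lipschitz: "norm (g n x - g n y) \<le> 4 * pi * B * \<bar>x - y\<bar>"
  using exp_hull_lipschitz[OF exp_hull_g, of n x y] by (simp add: mult_ac)

lemma norm_g_le_1: "norm (g n \<xi>) \<le> 1"
  by (rule LIMSEQ_le_const2[OF tendsto_norm[OF phi_tendsto]]) (use norm_phi_le_1 in auto)

lemma g_eq_phi: "g 0 \<xi> = phi 0 n \<xi> * g n (\<xi> / scale 0 n)"
proof (induction n)
  case (Suc n)
  show ?case
    by (subst Suc, subst g_Suc) (simp add: phi_Suc scale_Suc)
qed simp

end

section \<open>Children of a point and rational points\<close>

lemma dmask_shift:
  assumes "\<And>d. d \<in> D \<Longrightarrow> of_int d * c \<in> \<int>"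
  shows "dmask D (c + y) = dmask D y"
proof -
  have "ee (of_int d * (c + y)) = ee (of_int d * y)" if "d \<in> D" for d
    using assms[OF that] by (simp add: distrib_left ee_add ee_eq_1_iff[THEN iffD2])
  then show ?thesis by (simp add: dmask_def)
qed

lemma norm_one_plus_ee: "(norm (1 + ee t))\<^sup>2 = 2 + 2 * cos (2 * pi * t)"
proof -
  have "(norm (1 + ee t))\<^sup>2 = (1 + cos (2 * pi * t))\<^sup>2 + (sin (2 * pi * t))\<^sup>2"
    by (simp add: cmod_power2 ee_def)
  also have "\<dots> = 1 + 2 * cos (2 * pi * t) + ((sin (2 * pi * t))\<^sup>2 + (cos (2 * pi * t))\<^sup>2)"
    by (simp add: power2_eq_square algebra_simps)
  finally show ?thesis by simp
qed

lemma near_integer: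
  assumes "\<rho> > 0"
  shows "\<exists>\<kappa>>0. \<forall>t. norm (1 + ee t) \<ge> 2 - \<kappa> \<longrightarrow> (\<exists>k::int. \<bar>t - of_int k\<bar> \<le> \<rho>)"
proof -
  define r where "r = min \<rho> (1 / 2)"
  \<comment> \<open>Chosen so that \<open>(2 - \<kappa>)^2 \<ge> 4 - 4 * \<kappa> = 2 + 2 * cos (2 *
    pi * r)\<close>, which exceeds \<open>(norm (1 + ee t))^2\<close> once \<open>t\<close> is
    farther than \<open>r\<close> from the integers.\<close>
  define \<kappa> where "\<kappa> = (1 - cos (2 * pi * r)) / 2"
  have r: "0 < r" "r \<le> \<rho>" "r \<le> 1 / 2" using assms by (auto simp: r_def)
  have "cos (2 * pi * r) < cos 0"
    by (rule cos_monotone_0_pi) (use r in auto)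
  then have \<kappa>: "\<kappa> > 0" by (simp add: \<kappa>_def)
  have "\<kappa> \<le> 1" using cos_ge_minus_one[of "2 * pi * r"] by (simp add: \<kappa>_def)
  have "\<bar>t - of_int (round t)\<bar> \<le> \<rho>" if t: "norm (1 + ee t) \<ge> 2 - \<kappa>" for t
  proof (rule ccontr)
    define u where "u = \<bar>t - of_int (round t)\<bar>"
    assume "\<not> \<bar>t - of_int (round t)\<bar> \<le> \<rho>"
    then have u: "r < u" "u \<le> 1 / 2" using of_int_round_abs_le[of t] r by (auto simp: u_def abs_minus_commute)
    have "cos (2 * pi * u) < cos (2 * pi * r)"
      by (rule cos_monotone_0_pi) (use r u in auto)
    moreover have "ee (t - of_int (round t)) = ee t"
      using ee_add_int[of t "- round t"] by simp
    then have "cos (2 * pi * (t - of_int (round t))) = cos (2 * pi * t)"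
      unfolding ee_def by (metis cis.sel(1))
    then have "cos (2 * pi * u) = cos (2 * pi * t)"
      unfolding u_def by (metis abs_mult abs_numeral abs_of_pos cos_abs_real pi_gt_zero)
    moreover have "(2 - \<kappa>)\<^sup>2 \<le> 2 + 2 * cos (2 * pi * t)"
      unfolding norm_one_plus_ee[symmetric] using t \<open>\<kappa> \<le> 1\<close> by (intro power_mono) auto
    moreover have "4 - 4 * \<kappa> \<le> (2 - \<kappa>)\<^sup>2"
      by (simp add: power2_diff)
    ultimately show False by (simp add: \<kappa>_def field_simps)
  qed
  with \<kappa> show ?thesis by blast
qed

text \<open>The terms other than those of 0 and \<open>d\<close> have modulus 1 each, so little
  cancellation in the mask forces little in this pair. The digit 0 fixes the common phase as
  1.\<close>

lemma norm_one_plus_ee_ge: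
  assumes "finite D" "0 \<in> D" "d \<in> D" "d \<noteq> 0"
  shows "norm (1 + ee (of_int d * y)) \<ge> 2 - of_nat (card D) * (1 - norm (dmask D y))"
proof -
  have sub: "{0, d} \<subseteq> D" and cd: "card {0, d} = 2" using assms by auto
  have "card (D - {0, d}) = card D - 2" "card D \<ge> 2"
    using card_Diff_subset[OF _ sub] card_mono[OF assms(1) sub] cd by auto
  then have c: "real (card (D - {0, d})) = real (card D) - 2" by simp
  have pos: "card D > 0" using assms by (auto simp: card_gt_0_iff)
  have "of_nat (card D) * dmask D y = (\<Sum>e\<in>D. ee (of_int e * y))"
    using pos by (simp add: dmask_def)
  also have "\<dots> = (\<Sum>e\<in>D - {0, d}. ee (of_int e * y)) + (\<Sum>e\<in>{0, d}. ee (of_int e * y))"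
    by (rule sum.subset_diff[OF sub assms(1)])
  also have "(\<Sum>e\<in>{0, d}. ee (of_int e * y)) = 1 + ee (of_int d * y)"
    using assms by simp
  finally have "of_nat (card D) * norm (dmask D y) = norm ((\<Sum>e\<in>D - {0, d}. ee (of_int e * y)) + (1 + ee (of_int d * y)))"
    by (metis norm_mult norm_of_nat)
  also have "\<dots> \<le> norm (\<Sum>e\<in>D - {0, d}. ee (of_int e * y)) + norm (1 + ee (of_int d * y))"
    by (rule norm_triangle_ineq)
  also have "norm (\<Sum>e\<in>D - {0, d}. ee (of_int e * y)) \<le> real (card D) - 2"
    unfolding c[symmetric] by (rule order_trans[OF norm_sum]) simp
  finally show ?thesis by (simp add: algebra_simps)
qed

section \<open>Weights of the children of a point\<close>

locale hadamard_system = digit_system p D B for p D B +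
  fixes L :: "nat \<Rightarrow> int set" and P :: int
  assumes had: "n \<ge> 1 \<Longrightarrow> hadamard_triple (p n) (D n) (L n)"
    and p_le: "n \<ge> 1 \<Longrightarrow> p n \<le> P"
    and in_T_later: "n \<ge> 1 \<Longrightarrow> 0 < \<xi> \<Longrightarrow> \<xi> < 1 \<Longrightarrow> \<exists>k\<ge>n. \<xi> \<in> T_set (p k) (D k)"
begin

lemma P_gt_1: "P > 1"
  using p_gt_1[of 1] p_le[of 1] by simp

text \<open>By \<open>g_Suc\<close> this is the modulus of the factor met in passing from
  \<open>x + l\<close> to the child \<open>(x + l) / p n\<close>. It depends on \<open>l\<close>
  modulo \<open>p n\<close> only, so \<open>{0..<p n}\<close> labels the children.\<close>

definition wt :: "nat \<Rightarrow> real \<Rightarrow> int \<Rightarrow> real" where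
  "wt n x l = norm (dmask (D n) ((x + of_int l) / of_int (p n)))"

lemma wt_nonneg [simp]: "wt n x l \<ge> 0"
  by (simp add: wt_def)

lemma wt_mod: "n \<ge> 1 \<Longrightarrow> wt n x (l mod p n) = wt n x l"
  unfolding wt_def by (subst dmask_mod) (auto simp: p_gt_1)

lemma in_T_iff:
  assumes "n \<ge> 1"
  shows "x \<in> T_set (p n) (D n) \<longleftrightarrow> 0 \<le> x \<and> x < 1 \<and>
    (\<exists>l1\<in>{0..<p n}. \<exists>l2\<in>{0..<p n}. l1 \<noteq> l2 \<and> wt n x l1 \<noteq> 0 \<and> wt n x l2 \<noteq> 0)"
proof -
  have f: "fourier (delta ((\<lambda>d. of_int d / of_int (p n)) ` D n)) \<xi> = dmask (D n) (\<xi> / of_int (p n))" for \<xi>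
    using assms p_gt_1[of n] by (intro fourier_delta) (auto simp: finD D_ne)
  have s: "{0..p n - 1} = {0..<p n}" by auto
  show ?thesis
    unfolding T_set_def mem_Collect_eq wt_def norm_eq_zero f s by blast
qed

text \<open>Parseval's identity over \<open>L n\<close>, whose residues are distinct: the children
  other than \<open>l0\<close> contribute at most \<open>P * \<eta>^2\<close> to the total
  1.\<close>

lemma wt_dominates:
  assumes n: "n \<ge> 1" and l0: "l0 \<in> {0..<p n}" and \<eta>: "\<eta> \<ge> 0"
    and small: "\<And>l. l \<in> {0..<p n} \<Longrightarrow> l \<noteq> l0 \<Longrightarrow> wt n x l \<le> \<eta>"
  shows "1 - of_int P * \<eta>\<^sup>2 \<le> (wt n x l0)\<^sup>2"
proof -
  have inj: "inj_on (\<lambda>l. l mod p n) (L n)"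
    using hadamard_inj_mod[OF had[OF n] D_ne[OF n]] .
  have sub: "(\<lambda>l. l mod p n) ` L n \<subseteq> {0..<p n}"
    using p_gt_1[OF n] by auto
  have "1 = (\<Sum>l\<in>L n. (wt n x (l mod p n))\<^sup>2)"
    using hadamard_parseval[OF had[OF n] D_ne[OF n], of x] by (simp add: wt_mod[OF n]) (simp add: wt_def)
  also have "\<dots> = (\<Sum>r\<in>(\<lambda>l. l mod p n) ` L n. (wt n x r)\<^sup>2)"
    by (simp add: sum.reindex[OF inj])
  also have "\<dots> \<le> (\<Sum>r\<in>{0..<p n}. (wt n x r)\<^sup>2)"
    by (rule sum_mono2) (use sub in auto)
  also have "\<dots> \<le> (\<Sum>r\<in>{0..<p n}. (if r = l0 then (wt n x l0)\<^sup>2 else 0) + \<eta>\<^sup>2)"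
    using small by (intro sum_mono) (auto intro: power_mono)
  also have "\<dots> = (wt n x l0)\<^sup>2 + of_int (p n) * \<eta>\<^sup>2"
    using l0 p_gt_1[OF n] by (simp add: sum.distrib)
  also have "\<dots> \<le> (wt n x l0)\<^sup>2 + of_int P * \<eta>\<^sup>2"
    using p_le[OF n] by (intro add_left_mono mult_right_mono) auto
  finally show ?thesis by simp
qed

text \<open>At most \<open>P\<close> children share the Parseval mass 1.\<close>

lemma ex_heavy_child:
  assumes n: "n \<ge> 1"
  shows "\<exists>l\<in>{0..<p n}. wt n x l \<ge> 1 / (2 * of_int P)"
proof (rule ccontr)
  assume neg: "\<not> ?thesis"
  define \<eta> :: real where "\<eta> = 1 / (2 * of_int P)"
  have \<eta>: "\<eta> > 0" "of_int P * \<eta> = 1 / 2" "\<eta> \<le> 1 / 4"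
    using P_gt_1 by (auto simp: \<eta>_def field_simps)
  have 0: "0 \<in> {0..<p n}" using p_gt_1[OF n] by simp
  have "1 - of_int P * \<eta>\<^sup>2 \<le> (wt n x 0)\<^sup>2"
  proof (rule wt_dominates[OF n 0])
    show "wt n x l \<le> \<eta>" if "l \<in> {0..<p n}" for l
      using neg that unfolding \<eta>_def by (meson less_imp_le not_le)
  qed (use \<eta> in simp)
  also have "\<dots> \<le> (1 / 4)\<^sup>2"
  proof (intro power_mono)
    have "wt n x 0 < \<eta>" using neg 0 unfolding \<eta>_def by (meson not_le)
    then show "wt n x 0 \<le> 1 / 4" using \<eta> by simp
  qed simp
  also have "of_int P * \<eta>\<^sup>2 = \<eta> / 2"
    by (simp add: power2_eq_square mult.assoc[symmetric] \<eta>(2))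
  finally show False using \<eta>(3) by (simp add: power2_eq_square)
qed

definition two_children :: "nat \<Rightarrow> real \<Rightarrow> real \<Rightarrow> bool" where
  "two_children n \<eta> x \<longleftrightarrow> (\<exists>l1\<in>{0..<p n}. \<exists>l2\<in>{0..<p n}. l1 \<noteq> l2 \<and> wt n x l1 \<ge> \<eta> \<and> wt n x l2 \<ge> \<eta>)"

lemma not_two_children:
  assumes n: "n \<ge> 1" and "\<eta> \<ge> 0" and neg: "\<not> two_children n \<eta> x"
  shows "\<exists>l\<in>{0..<p n}. 1 - of_int P * \<eta>\<^sup>2 \<le> (wt n x l)\<^sup>2"
proof -
  have 0: "0 \<in> {0..<p n}" using p_gt_1[OF n] by simp
  obtain l0 where l0: "l0 \<in> {0..<p n}" "\<And>l. l \<in> {0..<p n} \<Longrightarrow> l \<noteq> l0 \<Longrightarrow> wt n x l \<le> \<eta>"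
  proof (cases "\<exists>l\<in>{0..<p n}. wt n x l \<ge> \<eta>")
    case True
    then show ?thesis using neg that unfolding two_children_def by (meson less_imp_le not_le)
  next
    case False
    then show ?thesis using that[OF 0] by (meson less_imp_le not_le)
  qed
  then show ?thesis using wt_dominates[OF n l0(1) \<open>\<eta> \<ge> 0\<close> l0(2)] by blast
qed

text \<open>The mask is then constantly 1 and \<open>p n \<ge> 2\<close>. Hence later arguments
  about points without two children have a nonzero digit at hand.\<close>

lemma two_children_trivial_digits:
  assumes n: "n \<ge> 1" and D: "D n = {0}" and "\<eta> \<le> 1"
  shows "two_children n \<eta> x"
proof -
  have [simp]: "wt n x l = 1" for l by (simp add: wt_def D dmask_def)
  show ?thesis
    unfolding two_children_def
    by (rule bexI[of _ 0], rule bexI[of _ 1]) (use p_gt_1[OF n] assms(3) in auto)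
qed

section \<open>The rational grid of exceptional points\<close>

definition digit_max :: int where
  "digit_max = \<lceil>B * of_int P\<rceil>"

lemma digit_le_max: "n \<ge> 1 \<Longrightarrow> d \<in> D n \<Longrightarrow> d \<le> digit_max"
proof -
  assume n: "n \<ge> 1" and d: "d \<in> D n"
  have "of_int d \<le> B * of_int (p n)"
    using digit_le[OF n d] p_gt_1[OF n] by (simp add: field_simps)
  also have "\<dots> \<le> B * of_int P"
    using p_le[OF n] B_nonneg by (intro mult_left_mono) auto
  finally have "real_of_int d \<le> of_int digit_max"
    unfolding digit_max_def by (meson le_of_int_ceiling order_trans)
  then show "d \<le> digit_max" by simp
qed

text \<open>A common multiple of the nonzero digits of all levels, so that \<open>k / d\<close> lies
  on the grid for every nonzero digit \<open>d\<close> and integer \<open>k\<close>.\<close>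

definition mesh :: nat where
  "mesh = fact (nat digit_max)"

definition grid :: "real set" where
  "grid = {x. of_nat mesh * x \<in> \<int>}"

lemma mesh_pos: "mesh > 0"
  by (simp add: mesh_def)

lemma digit_dvd_mesh:
  assumes "n \<ge> 1" "d \<in> D n" "d \<noteq> 0"
  shows "d dvd int mesh"
proof -
  have "d > 0" "nat d \<le> nat digit_max"
    using nonneg[OF assms(1,2)] digit_le_max[OF assms(1,2)] assms(3) by auto
  then have "nat d dvd mesh" unfolding mesh_def by (intro dvd_fact) auto
  then show ?thesis using \<open>d > 0\<close> by (metis int_dvd_int_iff int_nat_eq less_imp_le)
qed

lemma grid_if_digit_multiple:
  assumes "n \<ge> 1" "d \<in> D n" "d \<noteq> 0" "of_int d * y \<in> \<int>"
  shows "y \<in> grid"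
proof -
  obtain c where "int mesh = d * c" using digit_dvd_mesh[OF assms(1-3)] by (auto elim: dvdE)
  then have *: "real mesh * y = of_int c * (of_int d * y)"
    by (metis mult.assoc mult.commute of_int_mult of_int_of_nat_eq)
  show ?thesis unfolding grid_def mem_Collect_eq * by (rule Ints_mult[OF Ints_of_int assms(4)])
qed

text \<open>Some child \<open>y\<close> then has weight near 1, so \<open>d * y\<close> is near an
  integer \<open>k\<close> for a nonzero digit \<open>d\<close>, and \<open>y\<close> is near
  \<open>k / d\<close>. Going back to \<open>x = p n * y - l\<close> stays on the grid and enlarges
  distances at most by the factor \<open>P\<close>.\<close>

lemma near_grid:
  assumes \<rho>: "\<rho> > 0"
  shows "\<exists>\<eta>>0. \<forall>n\<ge>1. \<forall>x. \<not> two_children n \<eta> x \<longrightarrow> (\<exists>e\<in>grid. \<bar>x - e\<bar> \<le> \<rho>)"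
proof -
  have P: "of_int P > (1::real)" using P_gt_1 by simp
  obtain \<kappa> where \<kappa>: "\<kappa> > 0" "\<And>t. norm (1 + ee t) \<ge> 2 - \<kappa> \<Longrightarrow> \<exists>k::int. \<bar>t - of_int k\<bar> \<le> \<rho> / of_int P"
    using near_integer[of "\<rho> / of_int P"] \<rho> P by auto
  \<comment> \<open>Ensures \<open>P * (P * \<eta>^2) \<le> \<kappa>\<close>: one \<open>P\<close>
    bounds the number of digits, the other comes from \<open>not_two_children\<close>.\<close>
  define \<eta> where "\<eta> = min 1 (\<kappa> / (of_int P)\<^sup>2)"
  have \<eta>: "\<eta> > 0" "\<eta> \<le> 1" using \<kappa> P by (auto simp: \<eta>_def)
  have "(of_int P)\<^sup>2 * \<eta>\<^sup>2 \<le> (of_int P)\<^sup>2 * (\<eta> * 1)"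
    unfolding power2_eq_square[of \<eta>] using \<eta> by (intro mult_left_mono) auto
  also have "\<dots> \<le> (of_int P)\<^sup>2 * (\<kappa> / (of_int P)\<^sup>2)"
    by (intro mult_left_mono) (auto simp: \<eta>_def)
  also have "\<dots> = \<kappa>" using P by simp
  finally have \<eta>\<kappa>: "(of_int P)\<^sup>2 * \<eta>\<^sup>2 \<le> \<kappa>" .
  have "\<exists>e\<in>grid. \<bar>x - e\<bar> \<le> \<rho>" if n: "n \<ge> 1" and neg: "\<not> two_children n \<eta> x" for n x
  proof -
    obtain l where l: "l \<in> {0..<p n}" "1 - of_int P * \<eta>\<^sup>2 \<le> (wt n x l)\<^sup>2"
      using not_two_children[OF n _ neg] \<eta> by auto
    have "D n \<noteq> {0}" using two_children_trivial_digits[OF n] neg \<eta> by blast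
    then obtain d where d: "d \<in> D n" "d \<noteq> 0" using zeroD[OF n] by blast
    define y where "y = (x + of_int l) / of_int (p n)"
    have pn: "p n > 1" "real_of_int (p n) \<le> of_int P" using p_gt_1[OF n] p_le[OF n] by auto
    have "card (D n) = card ((\<lambda>l. l mod p n) ` L n)"
      using card_image[OF hadamard_inj_mod[OF had[OF n] D_ne[OF n]]] had[OF n] by (simp add: hadamard_triple_def)
    also have "\<dots> \<le> card {0..<p n}" using pn by (intro card_mono) auto
    finally have "real (card (D n)) \<le> of_int P" using pn by (simp add: le_nat_iff)
    moreover have w: "wt n x l \<le> 1" "wt n x l = norm (dmask (D n) y)"
      by (auto simp: wt_def norm_dmask_le_1 y_def)
    moreover have "(wt n x l)\<^sup>2 \<le> wt n x l"
      using w(1) by (simp add: power2_eq_square mult_left_le)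
    ultimately have "real (card (D n)) * (1 - norm (dmask (D n) y)) \<le> of_int P * (of_int P * \<eta>\<^sup>2)"
      using l(2) P by (intro mult_mono) auto
    then have "real (card (D n)) * (1 - norm (dmask (D n) y)) \<le> \<kappa>"
      using \<eta>\<kappa> by (simp add: power2_eq_square mult.assoc)
    then obtain k where k: "\<bar>of_int d * y - of_int k\<bar> \<le> \<rho> / of_int P"
      using norm_one_plus_ee_ge[OF finD[OF n] zeroD[OF n] d, of y] \<kappa>(2)[of "of_int d * y"] by auto
    define e where "e = of_int (p n) * (of_int k / of_int d) - real_of_int l"
    have "of_int k / of_int d \<in> grid"
      using d by (intro grid_if_digit_multiple[OF n d]) auto
    moreover have "real mesh * e = of_int (p n) * (real mesh * (of_int k / of_int d)) - of_int (int mesh * l)"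
      by (simp add: e_def right_diff_distrib)
    ultimately have "e \<in> grid"
      unfolding grid_def mem_Collect_eq by (metis Ints_diff Ints_mult Ints_of_int)
    moreover have "\<bar>x - e\<bar> \<le> \<rho>"
    proof -
      have "of_int (p n) * y = x + of_int l" using pn by (simp add: y_def)
      moreover have "(of_int d * y - of_int k) / of_int d = y - of_int k / of_int d"
        using d by (simp add: diff_divide_distrib)
      ultimately have "x - e = of_int (p n) * ((of_int d * y - of_int k) / of_int d)"
        by (simp add: e_def right_diff_distrib)
      then have "\<bar>x - e\<bar> = of_int (p n) * (\<bar>of_int d * y - of_int k\<bar> / \<bar>of_int d\<bar>)"
        using pn by (simp add: abs_mult)
      also have "\<dots> \<le> of_int P * (\<bar>of_int d * y - of_int k\<bar> / 1)"
        using pn d P by (intro mult_mono divide_left_mono) auto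
      also have "\<dots> \<le> of_int P * (\<rho> / of_int P)"
        using k P by (intro mult_left_mono) auto
      finally show ?thesis using P by simp
    qed
    ultimately show ?thesis by blast
  qed
  with \<eta> show ?thesis by blast
qed

text \<open>The last two conditions are recorded for the iteration: integrality feeds the
  divisibility argument, and grid membership allows the next step.\<close>

definition only_child :: "nat \<Rightarrow> real \<Rightarrow> int \<Rightarrow> bool" where
  "only_child n x l \<longleftrightarrow> l \<in> {0..<p n} \<and> wt n x l = 1 \<and> (\<forall>l'\<in>{0..<p n}. l' \<noteq> l \<longrightarrow> wt n x l' = 0) \<and>
    (\<forall>d\<in>D n. of_int d * ((x + of_int l) / of_int (p n)) \<in> \<int>) \<and> (x + of_int l) / of_int (p n) \<in> grid"

text \<open>Outside \<open>T\<close> one child carries the whole Parseval mass, so its mask value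
  has modulus 1; since 0 is a digit, every exponential in that mean equals 1.\<close>

lemma ex_only_child:
  assumes n: "n \<ge> 1" and x: "0 \<le> x" "x < 1" and T: "x \<notin> T_set (p n) (D n)"
  shows "\<exists>l. only_child n x l"
proof -
  have uniq: "l1 = l2" if "l1 \<in> {0..<p n}" "l2 \<in> {0..<p n}" "wt n x l1 \<noteq> 0" "wt n x l2 \<noteq> 0" for l1 l2
    using T x that unfolding in_T_iff[OF n] by blast
  obtain l where l: "l \<in> {0..<p n}" "wt n x l \<ge> 1 / (2 * of_int P)"
    using ex_heavy_child[OF n] by blast
  then have "wt n x l \<noteq> 0" using P_gt_1 by (metis divide_le_0_iff less_le_not_le mult_pos_pos of_int_0_less_iff zero_less_numeral zero_less_one less_trans not_le zero_less_divide_1_iff)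
  then have 0: "wt n x l' = 0" if "l' \<in> {0..<p n}" "l' \<noteq> l" for l'
    using uniq that l by blast
  have "1 \<le> (wt n x l)\<^sup>2"
    using wt_dominates[OF n l(1), of 0] 0 by simp
  moreover have "wt n x l \<le> 1" by (simp add: wt_def norm_dmask_le_1)
  ultimately have 1: "wt n x l = 1"
    by (metis one_le_power power2_eq_square mult_left_le wt_nonneg order_antisym order_trans)
  let ?y = "(x + of_int l) / of_int (p n)"
  have int: "of_int d * ?y \<in> \<int>" if d: "d \<in> D n" for d
  proof (cases "d = 0")
    case False
    define t where "t = of_int d * ?y"
    have "2 \<le> norm (1 + ee t)"
      using norm_one_plus_ee_ge[OF finD[OF n] zeroD[OF n] d False, of ?y] 1 by (simp add: wt_def t_def)
    then have "2\<^sup>2 \<le> (norm (1 + ee t))\<^sup>2" by (intro power_mono) auto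
    then have "cos (2 * pi * t) = 1"
      unfolding norm_one_plus_ee using cos_le_one[of "2 * pi * t"] by simp
    then obtain k :: int where "2 * pi * t = of_int k * 2 * pi"
      using cos_one_2pi_int by blast
    then have "t = of_int k" by simp
    then show ?thesis unfolding t_def by (metis Ints_of_int)
  qed simp
  \<comment> \<open>Otherwise all children would have weight 1; a nonzero digit is what places
    \<open>?y\<close> on the grid.\<close>
  have "D n \<noteq> {0}"
  proof
    assume "D n = {0}"
    then have "two_children n 1 x" using two_children_trivial_digits[OF n] by simp
    then show False using uniq unfolding two_children_def by fastforce
  qed
  then obtain d where "d \<in> D n" "d \<noteq> 0" using zeroD[OF n] by blast
  then have "?y \<in> grid" using grid_if_digit_multiple[OF n] int by blast
  then show ?thesis using l(1) 1 0 int unfolding only_child_def by blast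
qed

text \<open>The denominator \<open>q\<close> of a point outside \<open>T\<close> divides all digits and is prime to \<open>p n\<close>;
  hence it survives the passage to the only child, and \<open>1 / q\<close> is outside \<open>T\<close> as well.\<close>
lemma denominator_preserved:
  fixes a q :: int
  assumes n: "n \<ge> 1" and q: "q \<ge> 2" "coprime a q"
    and x: "x = of_int a / of_int q"
    and oc: "only_child n x l"
  shows "1 / of_int q \<notin> T_set (p n) (D n)"
    and "\<exists>a'. coprime a' q \<and> (x + of_int l) / of_int (p n) = of_int a' / of_int q"
proof -
  have p: "p n > 1" by (rule p_gt_1[OF n])
  have l: "l \<in> {0..<p n}" "wt n x l = 1" "\<And>l'. l' \<in> {0..<p n} \<Longrightarrow> l' \<noteq> l \<Longrightarrow> wt n x l' = 0"
    and int: "\<And>d. d \<in> D n \<Longrightarrow> of_int d * ((x + of_int l) / of_int (p n)) \<in> \<int>"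
    using oc by (auto simp: only_child_def)
  define y where "y = (x + of_int l) / of_int (p n)"
  \<comment> \<open>Integrality at the child \<open>y\<close> makes \<open>y\<close> a period of the
    mask, so the weights at \<open>x\<close> are those at 0 with labels shifted by
    \<open>l\<close>.\<close>
  have wt_shift: "wt n x l' = norm (dmask (D n) (of_int (l' - l) / of_int (p n)))" for l'
  proof -
    have "(x + of_int l') / of_int (p n) = y + of_int (l' - l) / of_int (p n)"
      by (simp add: y_def add_divide_distrib[symmetric])
    then show ?thesis using int by (simp add: wt_def dmask_shift y_def)
  qed
  \<comment> \<open>For a common divisor \<open>r\<close> of \<open>p n\<close> and all digits,
    \<open>1 / r\<close> would be a period of the mask, and \<open>l + p n / r\<close> would label a
    second child of weight 1.\<close>
  have common: "r = 1" if r: "r > 0" "r dvd p n" "\<And>d. d \<in> D n \<Longrightarrow> r dvd d" for r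
  proof (rule ccontr)
    assume "r \<noteq> 1"
    obtain s where s: "p n = r * s" using r(2) by (auto elim: dvdE)
    have "s > 0" using s p r(1) by (metis less_trans zero_less_mult_pos zero_less_one)
    then have "s < p n" using s \<open>r \<noteq> 1\<close> r(1) by (simp add: s)
    have "real_of_int d * (of_int s / of_int (p n)) \<in> \<int>" if "d \<in> D n" for d
    proof -
      obtain c where c: "d = r * c" using r(3)[OF \<open>d \<in> D n\<close>] by (auto elim: dvdE)
      have "of_int d * (of_int s / of_int (p n)) = real_of_int c"
        using r(1) \<open>s > 0\<close> by (simp add: s c)
      then show ?thesis by (metis Ints_of_int)
    qed
    then have "dmask (D n) (of_int s / of_int (p n) + 0) = dmask (D n) 0" by (rule dmask_shift)
    then have "wt n x (l + s) = 1"
      by (simp add: wt_shift dmask_0 finD[OF n] D_ne[OF n])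
    then have "wt n x ((l + s) mod p n) \<noteq> 0" by (simp add: wt_mod[OF n])
    moreover have "(l + s) mod p n \<in> {0..<p n}" using p by simp
    ultimately have "(l + s) mod p n = l mod p n" using l(1,3) by (metis mod_pos_pos_trivial atLeastLessThan_iff)
    then have "p n dvd s" by (simp add: mod_eq_dvd_iff)
    then show False using \<open>s > 0\<close> \<open>s < p n\<close> by (simp add: zdvd_not_zless)
  qed
  define b where "b = a + l * q"
  have cop: "coprime b q"
    using q(2) by (simp add: b_def coprime_iff_gcd_eq_1 gcd_add_mult mult.commute) (metis add.commute coprime_iff_gcd_eq_1 gcd.commute gcd_add_mult mult.commute)
  have y: "y = of_int b / (of_int (p n) * of_int q)"
    using q(1) p by (simp add: y_def x b_def field_simps)
  have k: "\<exists>k. d * b = k * (p n * q)" if d: "d \<in> D n" for d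
  proof -
    obtain k where "of_int d * y = of_int k" using int[OF d] by (auto simp: y_def elim: Ints_cases)
    then have "real_of_int (d * b) = of_int (k * (p n * q))"
      using q(1) p by (simp add: y field_simps)
    then show ?thesis by (metis of_int_eq_iff)
  qed
  have q_dvd: "q dvd d" if d: "d \<in> D n" for d
  proof -
    obtain k where "d * b = k * (p n * q)" using k[OF d] by blast
    then have "q dvd d * b" by simp
    then show ?thesis using cop by (simp add: coprime_commute coprime_dvd_mult_left_iff)
  qed
  \<comment> \<open>After cancelling \<open>q\<close> and \<open>gcd (p n) b\<close>, the remaining
    part \<open>r\<close> of \<open>p n\<close> is prime to \<open>b'\<close> and divides every
    digit, so \<open>common\<close> applies.\<close>
  have pb: "p n dvd b"
  proof -
    define r where "r = p n div gcd (p n) b"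
    have g: "gcd (p n) b > 0" using p by simp
    then have pr: "p n = r * gcd (p n) b" by (simp add: r_def)
    obtain b' where b': "b = b' * gcd (p n) b" by (metis dvdE gcd_dvd2 mult.commute)
    have "b' = b div gcd (p n) b" using b' g by (metis nonzero_mult_div_cancel_right less_irrefl)
    then have rb: "coprime r b'" using p by (auto simp: r_def intro: div_gcd_coprime)
    have "r dvd d" if d: "d \<in> D n" for d
    proof -
      obtain k where k: "d * b = k * (p n * q)" using k[OF d] by blast
      obtain c where c: "d = q * c" using q_dvd[OF d] by (auto elim: dvdE)
      have "q * gcd (p n) b * (c * b') = d * b" using c b' by (metis mult.assoc mult.commute)
      also have "\<dots> = q * gcd (p n) b * (k * r)" unfolding k using pr by (metis mult.assoc mult.commute)
      finally have *: "q * gcd (p n) b * (c * b') = q * gcd (p n) b * (k * r)" .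
      have "q \<noteq> 0" using q(1) by simp
      moreover have "gcd (p n) b \<noteq> 0" using g by (rule less_imp_neq[THEN not_sym])
      ultimately have "q * gcd (p n) b \<noteq> 0" by (simp only: mult_eq_0_iff de_Morgan_disj simp_thms)
      then have "c * b' = k * r" using * by (simp only: mult_cancel_left simp_thms)
      then have "r dvd c * b'" by simp
      then have "r dvd c" using rb by (simp add: coprime_dvd_mult_left_iff)
      then show ?thesis using c by simp
    qed
    moreover have "r > 0" using pr p g by (metis less_trans zero_less_mult_pos2 zero_less_one)
    moreover have "r dvd p n" using pr by (metis dvd_triv_left)
    ultimately have "r = 1" using common by blast
    then show ?thesis using pr by (metis gcd_dvd2 mult_1)
  qed
  then obtain a' where a': "b = p n * a'" by (auto elim: dvdE)
  then have "coprime a' q" using cop by (simp add: coprime_mult_left_iff)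
  moreover have "y = of_int a' / of_int q" using p by (simp add: y a')
  ultimately show "\<exists>a'. coprime a' q \<and> (x + of_int l) / of_int (p n) = of_int a' / of_int q"
    unfolding y_def by blast
  have "gcd (p n) q = 1"
    by (rule common) (use p q_dvd in \<open>auto intro: dvd_trans\<close>)
  then obtain u v where uv: "u * p n + v * q = 1" using bezout_int[of "p n" q] by metis
  \<comment> \<open>From \<open>1 / q = u * p n / q + v\<close>, where \<open>u / q\<close> is a
    period of the mask because \<open>q\<close> divides all digits: the weights at
    \<open>1 / q\<close> are a cyclic shift of those at \<open>x\<close>.\<close>
  have wt_q: "wt n (1 / of_int q) l' = wt n x ((l' + v + l) mod p n)" for l'
  proof -
    have "1 / of_int q = real_of_int (u * p n + v * q) / of_int q"
      unfolding uv by simp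
    also have "\<dots> = of_int u * of_int (p n) / of_int q + of_int v"
      using q(1) by (simp add: add_divide_distrib)
    finally have "(1 / of_int q + of_int l') / real_of_int (p n) = of_int u / of_int q + of_int (l' + v) / of_int (p n)"
      using p by (simp add: add_divide_distrib)
    moreover have "of_int d * (of_int u / real_of_int q) \<in> \<int>" if d: "d \<in> D n" for d
    proof -
      obtain c where c: "d = q * c" using q_dvd[OF d] by (auto elim: dvdE)
      have "of_int d * (of_int u / real_of_int q) = of_int (c * u)" using q(1) by (simp add: c)
      then show ?thesis by (metis Ints_of_int)
    qed
    ultimately show ?thesis
      unfolding wt_mod[OF n] wt_shift by (simp add: wt_def dmask_shift)
  qed
  have "l1 = l2" if "l1 \<in> {0..<p n}" "l2 \<in> {0..<p n}" "wt n (1 / of_int q) l1 \<noteq> 0" "wt n (1 / of_int q) l2 \<noteq> 0" for l1 l2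
  proof -
    have "(l1 + v + l) mod p n = l" "(l2 + v + l) mod p n = l"
      using that l(3) p unfolding wt_q by (metis atLeastLessThan_iff pos_mod_bound pos_mod_sign less_trans zero_less_one)+
    then have "p n dvd (l1 + v + l) - (l2 + v + l)" by (metis mod_eq_dvd_iff)
    then have "l1 mod p n = l2 mod p n" by (simp add: mod_eq_dvd_iff)
    then show ?thesis using that(1,2) by simp
  qed
  then show "1 / of_int q \<notin> T_set (p n) (D n)"
    unfolding in_T_iff[OF n] by blast
qed

end

section \<open>Equi-positivity\<close>

text \<open>Distance is taken on the circle, since arguments matter only up to integer
  translations.\<close>

definition mod1_separated :: "real \<Rightarrow> real set \<Rightarrow> bool" where
  "mod1_separated \<delta> S \<longleftrightarrow> S \<subseteq> {0..<1} \<and> (\<forall>x\<in>S. \<forall>y\<in>S. x \<noteq> y \<longrightarrow> (\<forall>k::int. \<delta> \<le> \<bar>x - y - of_int k\<bar>))"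

lemma mod1_separated_mono: "mod1_separated \<delta> S \<Longrightarrow> \<delta>' \<le> \<delta> \<Longrightarrow> mod1_separated \<delta>' S"
  unfolding mod1_separated_def by (meson order_trans)

context hadamard_system
begin

definition large_on :: "nat \<Rightarrow> real \<Rightarrow> real set \<Rightarrow> bool" where
  "large_on n c S \<longleftrightarrow> (\<exists>x\<in>S. \<exists>k::int. c \<le> norm (g n (x + of_int k)))"

lemma large_on_mono: "large_on n c S \<Longrightarrow> c' \<le> c \<Longrightarrow> large_on n c' S"
  unfolding large_on_def by (meson order_trans)

text \<open>The constant depends on \<open>s\<close> and \<open>\<delta>\<close> but not on the
  level or the set. All \<open>\<delta>\<close> are included because passing to children shrinks
  separations.\<close>

definition uniformly_large :: "nat \<Rightarrow> bool" where
  "uniformly_large s \<longleftrightarrow> (\<forall>\<delta>>0. \<exists>c>0. \<forall>n S. finite S \<longrightarrow> card S = s \<longrightarrow> mod1_separated \<delta> S \<longrightarrow> large_on n c S)"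

definition child :: "nat \<Rightarrow> real \<times> int \<Rightarrow> real" where
  "child n = (\<lambda>(x, l). (x + of_int l) / of_int (p n))"

text \<open>A difference of children modulo 1 is a difference of parents modulo 1, divided by
  \<open>p n\<close>. For a common parent the integer involved is nonzero, as the labels are
  distinct residues, and \<open>\<delta> \<le> 1\<close> suffices.\<close>

lemma mod1_separated_children:
  assumes n: "n \<ge> 1" and S: "mod1_separated \<delta> S" and \<delta>: "0 < \<delta>" "\<delta> \<le> 1"
    and J: "J \<subseteq> S \<times> {0..<p n}"
  shows "inj_on (child n) J" "mod1_separated (\<delta> / of_int P) (child n ` J)"
proof -
  have p: "p n > 1" "p n \<le> P" using p_gt_1[OF n] p_le[OF n] by auto
  have sep: "\<delta> / of_int P \<le> \<bar>child n (x, l) - child n (y, m) - of_int k\<bar>"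
    if xy: "(x, l) \<in> J" "(y, m) \<in> J" "(x, l) \<noteq> (y, m)" for x l y m k
  proof -
    have "\<delta> \<le> \<bar>x - y - of_int (k * p n - l + m)\<bar>"
    proof (cases "x = y")
      case False
      then show ?thesis using S xy J unfolding mod1_separated_def by blast
    next
      case True
      have "l - m - k * p n \<noteq> 0"
      proof
        assume "l - m - k * p n = 0"
        then have "p n dvd l - m" by (metis dvd_triv_right eq_iff_diff_eq_0)
        then have "l mod p n = m mod p n" by (simp add: mod_eq_dvd_iff)
        moreover have "l \<in> {0..<p n}" "m \<in> {0..<p n}" using xy J by auto
        ultimately have "l = m" by simp
        then show False using xy True by simp
      qed
      then have "1 \<le> \<bar>k * p n - l + m\<bar>" by linarith
      then have "1 \<le> \<bar>real_of_int (k * p n - l + m)\<bar>" by (metis of_int_1_le_iff of_int_abs)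
      then show ?thesis using True \<delta> by simp
    qed
    moreover have "child n (x, l) - child n (y, m) - of_int k = (x - y - of_int (k * p n - l + m)) / of_int (p n)"
      using p by (simp add: child_def field_simps)
    ultimately have "\<delta> / of_int (p n) \<le> \<bar>child n (x, l) - child n (y, m) - of_int k\<bar>"
      using p by (simp add: divide_right_mono)
    moreover have "\<delta> / of_int P \<le> \<delta> / of_int (p n)"
      using p \<delta> by (intro divide_left_mono) auto
    ultimately show ?thesis by simp
  qed
  have pos: "\<delta> / of_int P > 0" using \<delta> P_gt_1 by simp
  show "inj_on (child n) J"
  proof (rule inj_onI, rule ccontr)
    fix a b assume "a \<in> J" "b \<in> J" "child n a = child n b" "a \<noteq> b"
    then show False using sep[of "fst a" "snd a" "fst b" "snd b" 0] pos by simp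
  qed
  have "child n ` J \<subseteq> {0..<1}"
  proof clarify
    fix x l assume "(x, l) \<in> J"
    then have "0 \<le> x" "x < 1" "0 \<le> l" "l \<le> p n - 1" using J S by (auto simp: mod1_separated_def)
    moreover from this(4) have "real_of_int l \<le> of_int (p n) - 1" by linarith
    ultimately show "child n (x, l) \<in> {0..<1}" using p by (simp add: child_def)
  qed
  with sep show "mod1_separated (\<delta> / of_int P) (child n ` J)"
    unfolding mod1_separated_def by fast
qed

text \<open>By \<open>g_Suc\<close>, a value at the parent is the weight times a value at the child;
  the shift \<open>k\<close> of the child is the shift \<open>l + p (Suc n) * k\<close> of the
  parent.\<close>

lemma large_on_parents:
  assumes "large_on (Suc n) c (child (Suc n) ` J)" "J \<subseteq> S \<times> UNIV" "w \<ge> 0" "c \<ge> 0"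
    and w: "\<And>x l. (x, l) \<in> J \<Longrightarrow> w \<le> wt (Suc n) x l"
  shows "large_on n (w * c) S"
proof -
  obtain z k where z: "z \<in> J" "c \<le> norm (g (Suc n) (child (Suc n) z + of_int k))"
    using assms(1) unfolding large_on_def by blast
  obtain x l where "z = (x, l)" by (cases z)
  with z have J: "(x, l) \<in> J" and k: "c \<le> norm (g (Suc n) (child (Suc n) (x, l) + of_int k))"
    by simp_all
  have p: "p (Suc n) > 1" by (simp add: p_gt_1)
  have *: "(x + of_int (l + p (Suc n) * k)) / of_int (p (Suc n)) = child (Suc n) (x, l) + of_int k"
    using p by (simp add: child_def field_simps)
  have "w * c \<le> wt (Suc n) x l * norm (g (Suc n) (child (Suc n) (x, l) + of_int k))"
    using w[OF J] k assms by (intro mult_mono) auto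
  also have "wt (Suc n) x l = norm (dmask (D (Suc n)) (child (Suc n) (x, l) + of_int k))"
    by (simp add: wt_def child_def dmask_add_int)
  finally have "w * c \<le> norm (g n (x + of_int (l + p (Suc n) * k)))"
    unfolding g_Suc[of n] * norm_mult .
  then show ?thesis using J assms(2) unfolding large_on_def by blast
qed

text \<open>A heavy child of every point together with a second child of the branching point gives
  \<open>s + 1\<close> points at the next level, separated by \<open>\<delta> / P\<close>.\<close>

lemma branching:
  assumes ul: "uniformly_large (Suc s)" and \<delta>: "0 < \<delta>" "\<delta> \<le> 1" and \<eta>: "\<eta> > 0"
  shows "\<exists>c>0. \<forall>n S. finite S \<longrightarrow> card S = s \<longrightarrow> mod1_separated \<delta> S \<longrightarrow>
    (\<exists>y\<in>S. two_children (Suc n) \<eta> y) \<longrightarrow> large_on n c S"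
proof -
  have "\<delta> / of_int P > 0" using \<delta> P_gt_1 by simp
  then obtain c where c: "c > 0" "\<And>n S. finite S \<Longrightarrow> card S = Suc s \<Longrightarrow> mod1_separated (\<delta> / of_int P) S \<Longrightarrow> large_on n c S"
    using ul unfolding uniformly_large_def by blast
  define w where "w = min \<eta> (1 / (2 * of_int P))"
  have w: "w > 0" using \<eta> P_gt_1 by (simp add: w_def)
  have "large_on n (w * c) S"
    if S: "finite S" "card S = s" "mod1_separated \<delta> S" and y: "y \<in> S" "two_children (Suc n) \<eta> y" for n S y
  proof -
    have "\<forall>x. \<exists>l\<in>{0..<p (Suc n)}. wt (Suc n) x l \<ge> 1 / (2 * of_int P)"
      using ex_heavy_child[of "Suc n"] by simp
    then obtain h where h: "\<And>x. h x \<in> {0..<p (Suc n)}" "\<And>x. wt (Suc n) x (h x) \<ge> 1 / (2 * of_int P)"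
      by metis
    obtain l where l: "l \<in> {0..<p (Suc n)}" "l \<noteq> h y" "wt (Suc n) y l \<ge> \<eta>"
      using y(2) unfolding two_children_def by metis
    define J where "J = insert (y, l) ((\<lambda>x. (x, h x)) ` S)"
    have J: "J \<subseteq> S \<times> {0..<p (Suc n)}" using l h y by (auto simp: J_def)
    have "finite J" using S by (simp add: J_def)
    have "(y, l) \<notin> (\<lambda>x. (x, h x)) ` S" using l by auto
    moreover have "card ((\<lambda>x. (x, h x)) ` S) = s"
      using S by (subst card_image) (auto intro: inj_onI)
    ultimately have "card J = Suc s" using S by (simp add: J_def)
    have 1: "1 \<le> Suc n" by simp
    note ch = mod1_separated_children[OF 1 S(3) \<delta> J]
    have "large_on (Suc n) c (child (Suc n) ` J)"
      using ch \<open>finite J\<close> \<open>card J = Suc s\<close> by (intro c) (auto simp: card_image)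
    then show ?thesis
    proof (rule large_on_parents)
      show "w \<le> wt (Suc n) x m" if "(x, m) \<in> J" for x m
        using that l(3) h(2)[of x] by (auto simp: J_def w_def min_le_iff_disj)
    qed (use J w c in auto)
  qed
  moreover have "w * c > 0" using w c by simp
  ultimately show ?thesis by blast
qed

text \<open>Bounded bases and digits leave finitely many combinations of base, digit set, grid point
  in \<open>[0, 1)\<close> and label.\<close>

lemma ex_min_weight_on_grid:
  "\<exists>\<eta>>0. \<forall>n\<ge>1. \<forall>x\<in>grid \<inter> {0..<1}. \<forall>l\<in>{0..<p n}. wt n x l \<noteq> 0 \<longrightarrow> \<eta> \<le> wt n x l"
proof -
  define G where "G = (\<lambda>j. real_of_int j / of_nat mesh) ` {0..<int mesh}"
  define V where "V = (\<lambda>(q, E, x, l). norm (dmask E ((x + of_int l) / of_int q))) ` ({2..P} \<times> Pow {0..digit_max} \<times> G \<times> {0..<P})"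
  define V' where "V' = insert 1 (V - {0})"
  have fin: "finite V'" by (simp add: V'_def V_def G_def)
  have "\<forall>v\<in>V'. v > 0" by (auto simp: V'_def V_def)
  then have "Min V' > 0" using fin by (subst Min_gr_iff) (auto simp: V'_def)
  moreover have "Min V' \<le> wt n x l"
    if n: "n \<ge> 1" and x: "x \<in> grid" "0 \<le> x" "x < 1" and l: "l \<in> {0..<p n}" and nz: "wt n x l \<noteq> 0" for n x l
  proof -
    obtain j where j: "real mesh * x = of_int j" using x by (auto simp: grid_def elim: Ints_cases)
    then have xj: "x = of_int j / of_nat mesh" using mesh_pos by (simp add: field_simps)
    have "0 \<le> real_of_int j" "real_of_int j < of_nat mesh"
      using x mesh_pos by (auto simp: j[symmetric])
    then have "j \<in> {0..<int mesh}" by simp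
    then have "x \<in> G" unfolding G_def xj by blast
    moreover have "p n \<in> {2..P}" "l \<in> {0..<P}" using p_gt_1[OF n] p_le[OF n] l by auto
    moreover have "D n \<in> Pow {0..digit_max}" using nonneg[OF n] digit_le_max[OF n] by auto
    ultimately have "wt n x l \<in> V"
      unfolding V_def wt_def by (intro image_eqI[where x = "(p n, D n, x, l)"]) simp_all
    then show ?thesis using nz fin by (intro Min_le) (auto simp: V'_def)
  qed
  ultimately show ?thesis by (intro exI[of _ "Min V'"]) auto
qed

lemma mod1_separated_grid:
  assumes "S \<subseteq> grid \<inter> {0..<1}"
  shows "mod1_separated (1 / of_nat mesh) S"
  unfolding mod1_separated_def
proof (intro conjI ballI impI allI)
  fix x y and k :: int assume xy: "x \<in> S" "y \<in> S" "x \<noteq> y"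
  then have "real mesh * x \<in> \<int>" "real mesh * y \<in> \<int>"
    using assms by (auto simp: grid_def)
  then obtain i j where ij: "real mesh * x = of_int i" "real mesh * y = of_int j"
    by (elim Ints_cases)
  define m where "m = i - j - int mesh * k"
  have m: "of_int m = real mesh * (x - y - of_int k)"
    by (simp add: m_def right_diff_distrib ij)
  have "x - y \<noteq> of_int k"
  proof
    assume *: "x - y = of_int k"
    have "x \<in> {0..<1}" "y \<in> {0..<1}" using xy assms by auto
    then have "\<bar>x - y\<bar> < 1" unfolding atLeastLessThan_iff by linarith
    then have "k = 0" unfolding * by (simp add: of_int_abs[symmetric] del: of_int_abs)
    then show False using * xy by simp
  qed
  then have "m \<noteq> 0" using m mesh_pos by (metis eq_iff_diff_eq_0 mult_eq_0_iff of_int_0 of_nat_eq_0_iff less_irrefl)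
  then have "1 \<le> \<bar>of_int m :: real\<bar>" by (simp add: of_int_abs[symmetric] del: of_int_abs)
  then have "1 \<le> real mesh * \<bar>x - y - of_int k\<bar>" unfolding m by (simp add: abs_mult)
  then show "1 / real mesh \<le> \<bar>x - y - of_int k\<bar>"
    using mesh_pos by (simp add: field_simps)
qed (use assms in auto)

text \<open>As long as no point of \<open>S\<close> branches, \<open>S\<close> moves along its only children without loss, and a
  point \<open>a / q\<close> of \<open>S\<close> keeps its denominator. This ends at the latest when \<open>1 / q\<close> lies in \<open>T\<close>.\<close>
lemma large_on_grid_with_fraction:
  fixes q :: int
  assumes c: "0 < c"
    and branch: "\<And>n S. finite S \<Longrightarrow> card S = s \<Longrightarrow> S \<subseteq> grid \<inter> {0..<1} \<Longrightarrow> \<exists>x\<in>S. x \<in> T_set (p (Suc n)) (D (Suc n)) \<Longrightarrow> large_on n c S"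
    and q: "q \<ge> 2" and T: "1 / of_int q \<in> T_set (p k) (D k)"
    and "n + Suc j = k" "finite S" "card S = s" "S \<subseteq> grid \<inter> {0..<1}"
    and "coprime a q" "of_int a / of_int q \<in> S"
  shows "large_on n c S"
  using assms(5-)
\<comment> \<open>Level \<open>n\<close> is governed by \<open>p (Suc n)\<close>, so
  \<open>j = 0\<close> is the case where the very next step is the one with \<open>1 / q\<close> in
  \<open>T\<close>.\<close>
proof (induction j arbitrary: n S a)
  case (0 n S a)
  show ?case
  proof (rule branch[OF 0(2-4)], rule ccontr)
    assume neg: "\<not> (\<exists>x\<in>S. x \<in> T_set (p (Suc n)) (D (Suc n)))"
    let ?x = "of_int a / real_of_int q"
    have "0 \<le> ?x" "?x < 1" "?x \<notin> T_set (p (Suc n)) (D (Suc n))" using 0 neg by auto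
    then obtain l where l: "only_child (Suc n) ?x l"
      using ex_only_child[of "Suc n" ?x] by auto
    have "1 / of_int q \<notin> T_set (p (Suc n)) (D (Suc n))"
      by (rule denominator_preserved(1)[OF _ q 0(5) refl l]) simp
    then show False using T 0(1) by simp
  qed
next
  case (Suc j n S a)
  show ?case
  proof (cases "\<exists>x\<in>S. x \<in> T_set (p (Suc n)) (D (Suc n))")
    case True
    then show ?thesis using branch Suc.prems by blast
  next
    case False
    have "\<exists>l. only_child (Suc n) x l" if "x \<in> S" for x
      using that False Suc.prems(4) by (intro ex_only_child) auto
    then obtain h where h: "\<And>x. x \<in> S \<Longrightarrow> only_child (Suc n) x (h x)"
      by metis
    then have h': "\<And>x. x \<in> S \<Longrightarrow> h x \<in> {0..<p (Suc n)}" "\<And>x. x \<in> S \<Longrightarrow> wt (Suc n) x (h x) = 1"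
      "\<And>x. x \<in> S \<Longrightarrow> child (Suc n) (x, h x) \<in> grid"
      by (simp_all add: only_child_def child_def)
    define J where "J = (\<lambda>x. (x, h x)) ` S"
    let ?x = "of_int a / real_of_int q"
    have 1: "1 \<le> Suc n" by simp
    have x: "?x \<in> S" using Suc.prems by simp
    obtain a' where a': "coprime a' q" "child (Suc n) (?x, h ?x) = of_int a' / of_int q"
      using denominator_preserved(2)[OF 1 q Suc.prems(5) refl h[OF x]] by (auto simp: child_def)
    have J: "J \<subseteq> S \<times> {0..<p (Suc n)}" using h'(1) by (auto simp: J_def)
    have mesh: "0 < 1 / real mesh" "1 / real mesh \<le> 1" using mesh_pos by (auto simp: field_simps)
    note ch = mod1_separated_children[OF 1 mod1_separated_grid[OF Suc.prems(4)] mesh J]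
    have "card J = s" using Suc.prems by (simp add: J_def card_image inj_on_def)
    have "large_on (Suc n) c (child (Suc n) ` J)"
    proof (rule Suc.IH)
      show "of_int a' / of_int q \<in> child (Suc n) ` J" using a' x by (force simp: J_def)
      show "card (child (Suc n) ` J) = s" using ch \<open>card J = s\<close> by (simp add: card_image)
      show "child (Suc n) ` J \<subseteq> grid \<inter> {0..<1}" using ch(2) h'(3) by (auto simp: mod1_separated_def J_def)
    qed (use Suc.prems a' in \<open>auto simp: J_def\<close>)
    \<comment> \<open>The weights are exactly 1, so \<open>c\<close> does not depend on the length
      of the wait.\<close>
    then have "large_on n (1 * c) S"
      by (rule large_on_parents) (use h'(2) c J in \<open>auto simp: J_def\<close>)
    then show ?thesis by simp
  qed
qed

text \<open>For a grid point, lying in \<open>T\<close> already means two children of a definite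
  least weight. A nonzero point of \<open>S\<close> is a reduced fraction with some
  \<open>q \<ge> 2\<close>, and \<open>1 / q\<close> lies in \<open>T\<close> at some later level;
  how late does not affect the constant.\<close>

lemma large_on_grid:
  assumes ul: "uniformly_large (Suc s)" and s: "s \<ge> 1"
  shows "\<exists>c>0. \<forall>n S. finite S \<longrightarrow> card S = s \<longrightarrow> S \<subseteq> grid \<inter> {0..<1} \<longrightarrow> large_on n c S"
proof -
  obtain \<eta> where \<eta>: "\<eta> > 0" "\<And>n x l. n \<ge> 1 \<Longrightarrow> x \<in> grid \<inter> {0..<1} \<Longrightarrow> l \<in> {0..<p n} \<Longrightarrow> wt n x l \<noteq> 0 \<Longrightarrow> \<eta> \<le> wt n x l"
    using ex_min_weight_on_grid by metis
  have mesh: "0 < 1 / real mesh" "1 / real mesh \<le> 1" using mesh_pos by (auto simp: field_simps)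
  obtain c0 where c0: "c0 > 0" "\<And>n S. finite S \<Longrightarrow> card S = s \<Longrightarrow> mod1_separated (1 / real mesh) S \<Longrightarrow>
    (\<exists>y\<in>S. two_children (Suc n) \<eta> y) \<Longrightarrow> large_on n c0 S"
    using branching[OF ul mesh \<eta>(1)] by blast
  \<comment> \<open>The entry 1 serves the sets containing 0, where \<open>g n\<close> is 1.\<close>
  define c where "c = min c0 1"
  have c: "c > 0" using c0 by (simp add: c_def)
  have branch: "large_on n c S" if S: "finite S" "card S = s" "S \<subseteq> grid \<inter> {0..<1}"
    and T: "\<exists>x\<in>S. x \<in> T_set (p (Suc n)) (D (Suc n))" for n S
  proof -
    obtain x where x: "x \<in> S" "x \<in> T_set (p (Suc n)) (D (Suc n))" using T by blast
    obtain l1 l2 where l: "l1 \<in> {0..<p (Suc n)}" "l2 \<in> {0..<p (Suc n)}" "l1 \<noteq> l2"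
      "wt (Suc n) x l1 \<noteq> 0" "wt (Suc n) x l2 \<noteq> 0"
      using x(2) in_T_iff[of "Suc n" x] by auto
    have "x \<in> grid \<inter> {0..<1}" using x(1) S(3) by blast
    then have "\<eta> \<le> wt (Suc n) x l1" "\<eta> \<le> wt (Suc n) x l2"
      using \<eta>(2)[of "Suc n" x] l by simp_all
    then have "two_children (Suc n) \<eta> x"
      unfolding two_children_def using l(1-3) by blast
    then have "large_on n c0 S" using c0(2)[OF S(1,2) mod1_separated_grid[OF S(3)]] x by blast
    then show ?thesis by (rule large_on_mono) (simp add: c_def)
  qed
  have "large_on n c S" if S: "finite S" "card S = s" "S \<subseteq> grid \<inter> {0..<1}" for n S
  proof -
    obtain x where x: "x \<in> S" using S s by fastforce
    show ?thesis
    proof (cases "x = 0")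
      case True
      have "c \<le> norm (g n (0 + of_int 0))" by (simp add: c_def)
      then show ?thesis using x True unfolding large_on_def by blast
    next
      case False
      have x01: "0 < x" "x < 1" "x \<in> grid" using x False S by (auto simp: less_le)
      obtain j where j: "real mesh * x = of_int j" using x01 by (auto simp: grid_def elim: Ints_cases)
      define r where "r = gcd j (int mesh)"
      define a q where "a = j div r" and "q = int mesh div r"
      have r: "r > 0" using mesh_pos by (simp add: r_def)
      have q: "int mesh = q * r" and a: "j = a * r" by (simp_all add: q_def a_def r_def)
      have "coprime a q" using mesh_pos unfolding a_def q_def r_def by (intro div_gcd_coprime) auto
      have "q > 0" using q mesh_pos r by (metis of_nat_0_less_iff zero_less_mult_pos2)
      have "real mesh = of_int q * of_int r" using q by (metis of_int_mult of_int_of_nat_eq)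
      then have "of_int r * (of_int q * x) = of_int r * real_of_int a"
        using j by (simp add: a mult_ac)
      then have xa: "x = of_int a / of_int q" using r \<open>q > 0\<close> by (simp add: field_simps)
      have "q \<noteq> 1" using x01 by (auto simp: xa)
      with \<open>q > 0\<close> have q2: "q \<ge> 2" by simp
      have q01: "0 < 1 / real_of_int q" "1 / real_of_int q < 1" using q2 by auto
      obtain k where k: "k \<ge> Suc n" "1 / real_of_int q \<in> T_set (p k) (D k)"
        using in_T_later[OF _ q01, of "Suc n"] by auto
      show ?thesis
        by (rule large_on_grid_with_fraction[where n = n and j = "k - Suc n" and S = S and a = a, OF c branch q2 k(2)])
           (use k S x xa \<open>coprime a q\<close> in auto)
    qed
  qed
  with c show ?thesis by blast
qed

text \<open>Either a point of \<open>S\<close> branches, or all of \<open>S\<close> is close to the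
  grid and can be moved onto it; the move keeps the number of points and changes \<open>g n\<close>
  little.\<close>

lemma uniformly_large_step:
  assumes ul: "uniformly_large (Suc s)" and s: "s \<ge> 1"
  shows "uniformly_large s"
  unfolding uniformly_large_def
proof (intro allI impI)
  fix \<delta>0 :: real assume "\<delta>0 > 0"
  define \<delta> where "\<delta> = min \<delta>0 1"
  have \<delta>: "0 < \<delta>" "\<delta> \<le> 1" "\<delta> \<le> \<delta>0" using \<open>\<delta>0 > 0\<close> by (auto simp: \<delta>_def)
  obtain c1 where c1: "c1 > 0" "\<And>n S. finite S \<Longrightarrow> card S = s \<Longrightarrow> S \<subseteq> grid \<inter> {0..<1} \<Longrightarrow> large_on n c1 S"
    using large_on_grid[OF ul s] by blast
  define K where "K = 4 * pi * B + 1"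
  have K: "K > 0" using B_nonneg by (simp add: K_def add_nonneg_pos)
  \<comment> \<open>The first entry keeps the rounded points distinct modulo 1, the second keeps the
    Lipschitz loss at most \<open>c1 / 2\<close>.\<close>
  define \<rho> where "\<rho> = min (\<delta> / 3) (c1 / (2 * K))"
  have \<rho>: "\<rho> > 0" "2 * \<rho> < \<delta>" "K * \<rho> \<le> c1 / 2"
  proof -
    show "\<rho> > 0" using \<delta> c1 K by (simp add: \<rho>_def)
    show "2 * \<rho> < \<delta>" using \<delta> by (simp add: \<rho>_def min_def)
    have "K * \<rho> \<le> K * (c1 / (2 * K))" using K by (intro mult_left_mono) (auto simp: \<rho>_def)
    then show "K * \<rho> \<le> c1 / 2" using K by simp
  qed
  obtain \<eta> where \<eta>: "\<eta> > 0" "\<And>n x. n \<ge> 1 \<Longrightarrow> \<not> two_children n \<eta> x \<Longrightarrow> \<exists>e\<in>grid. \<bar>x - e\<bar> \<le> \<rho>"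
    using near_grid[OF \<rho>(1)] by blast
  obtain c2 where c2: "c2 > 0" "\<And>n S. finite S \<Longrightarrow> card S = s \<Longrightarrow> mod1_separated \<delta> S \<Longrightarrow>
    (\<exists>y\<in>S. two_children (Suc n) \<eta> y) \<Longrightarrow> large_on n c2 S"
    using branching[OF ul \<delta>(1,2) \<eta>(1)] by blast
  define c where "c = min c2 (c1 / 2)"
  have "c > 0" using c1 c2 by (simp add: c_def)
  moreover have "large_on n c S" if S: "finite S" "card S = s" "mod1_separated \<delta>0 S" for n S
  proof (cases "\<exists>y\<in>S. two_children (Suc n) \<eta> y")
    case True
    have "large_on n c2 S" by (rule c2(2)[OF S(1,2) mod1_separated_mono[OF S(3) \<delta>(3)] True])
    then show ?thesis by (rule large_on_mono) (simp add: c_def)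
  next
    case False
    then have "\<exists>e\<in>grid. \<bar>x - e\<bar> \<le> \<rho>" if "x \<in> S" for x
      using \<eta>(2)[of "Suc n"] that by auto
    then obtain e where e: "\<And>x. x \<in> S \<Longrightarrow> e x \<in> grid" "\<And>x. x \<in> S \<Longrightarrow> \<bar>x - e x\<bar> \<le> \<rho>"
      by metis
    \<comment> \<open>The grid is invariant under integers; the integer part removed here is
      absorbed into the translation \<open>k'\<close>.\<close>
    define f where "f x = frac (e x)" for x
    have f: "f x \<in> grid" if "x \<in> S" for x
      using e(1)[OF that] by (auto simp: grid_def f_def frac_def right_diff_distrib intro!: Ints_diff)
    have "inj_on f S"
    proof (rule inj_onI, rule ccontr)
      fix x y assume xy: "x \<in> S" "y \<in> S" "f x = f y" "x \<noteq> y"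
      then have "\<delta>0 \<le> \<bar>x - y - of_int (\<lfloor>e x\<rfloor> - \<lfloor>e y\<rfloor>)\<bar>"
        using S(3) unfolding mod1_separated_def by blast
      also have "x - y - of_int (\<lfloor>e x\<rfloor> - \<lfloor>e y\<rfloor>) = (x - e x) - (y - e y)"
        using xy(3) by (simp add: f_def frac_def)
      also have "\<bar>(x - e x) - (y - e y)\<bar> \<le> \<rho> + \<rho>"
        using e(2)[OF xy(1)] e(2)[OF xy(2)] by linarith
      finally show False using \<rho> \<delta> by simp
    qed
    then have "card (f ` S) = s" using S by (simp add: card_image)
    moreover have "f ` S \<subseteq> grid \<inter> {0..<1}" using f by (auto simp: f_def frac_ge_0 frac_lt_1)
    ultimately have "large_on n c1 (f ` S)" using S by (intro c1(2)) simp_all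
    then obtain x k where x: "x \<in> S" "c1 \<le> norm (g n (f x + of_int k))"
      unfolding large_on_def by blast
    define k' where "k' = k - \<lfloor>e x\<rfloor>"
    have "norm (g n (f x + of_int k) - g n (x + of_int k')) \<le> 4 * pi * B * \<bar>(f x + of_int k) - (x + of_int k')\<bar>"
      by (rule g_lipschitz)
    also have "(f x + of_int k) - (x + of_int k') = - (x - e x)"
      by (simp add: f_def k'_def frac_def)
    also have "4 * pi * B * \<bar>- (x - e x)\<bar> \<le> K * \<rho>"
      unfolding abs_minus_cancel using e(2)[OF x(1)] B_nonneg K by (intro mult_mono) (auto simp: K_def)
    finally have "norm (g n (f x + of_int k) - g n (x + of_int k')) \<le> c1 / 2" using \<rho>(3) by simp
    moreover have "norm (g n (f x + of_int k)) \<le> norm (g n (f x + of_int k) - g n (x + of_int k')) + norm (g n (x + of_int k'))"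
      using norm_triangle_ineq[of "g n (f x + of_int k) - g n (x + of_int k')" "g n (x + of_int k')"] by simp
    ultimately have "c \<le> norm (g n (x + of_int k'))" using x(2) by (simp add: c_def min_def)
    then show ?thesis using x(1) unfolding large_on_def by blast
  qed
  ultimately show "\<exists>c>0. \<forall>n S. finite S \<longrightarrow> card S = s \<longrightarrow> mod1_separated \<delta>0 S \<longrightarrow> large_on n c S"
    by blast
qed

text \<open>The start of the downward induction: \<open>g n\<close> has frequencies in
  \<open>[0, 2 * B]\<close> in the sense of \<open>exp_hull\<close>, so enough nodes make the
  interpolation error at most 1/2.\<close>

lemma ex_uniformly_large: "\<exists>k\<ge>1. uniformly_large k"
proof -
  obtain k where k: "k \<ge> 1" "(2 * pi * (2 * B)) ^ k / fact k \<le> 1 / 2"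
    using ex_power_div_fact_le_half by blast
  have "uniformly_large k"
    unfolding uniformly_large_def
  proof (intro allI impI)
    fix \<delta> :: real assume "\<delta> > 0"
    have "0 \<le> 2 * B" using B_nonneg by simp
    from exp_hull_large_value[OF this k(2) \<open>\<delta> > 0\<close>]
    obtain \<epsilon> where \<epsilon>: "\<epsilon> > 0" "\<And>h S. exp_hull (2 * B) h \<Longrightarrow> h 0 = 1 \<Longrightarrow> finite S \<Longrightarrow> card S = k \<Longrightarrow> S \<subseteq> {0..1} \<Longrightarrow>
      (\<forall>x\<in>S. \<forall>y\<in>S. x \<noteq> y \<longrightarrow> \<delta> \<le> \<bar>x - y\<bar>) \<Longrightarrow> \<exists>y\<in>S. norm (h y) \<ge> \<epsilon>"
      by blast
    have "large_on n \<epsilon> S" if S: "finite S" "card S = k" "mod1_separated \<delta> S" for n S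
    proof -
      have "\<delta> \<le> \<bar>x - y\<bar>" if "x \<in> S" "y \<in> S" "x \<noteq> y" for x y
      proof -
        have "\<delta> \<le> \<bar>x - y - of_int 0\<bar>" using S(3) that unfolding mod1_separated_def by blast
        then show ?thesis by simp
      qed
      moreover have "S \<subseteq> {0..1}" using S(3) unfolding mod1_separated_def by (auto intro: less_imp_le)
      ultimately obtain y where y: "y \<in> S" "\<epsilon> \<le> norm (g n y)"
        using \<epsilon>(2)[OF exp_hull_g g_0 S(1,2)] by blast
      then have "\<epsilon> \<le> norm (g n (y + of_int 0))" by simp
      with y(1) show ?thesis unfolding large_on_def by blast
    qed
    with \<epsilon>(1) show "\<exists>c>0. \<forall>n S. finite S \<longrightarrow> card S = k \<longrightarrow> mod1_separated \<delta> S \<longrightarrow> large_on n c S"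
      by blast
  qed
  with k(1) show ?thesis by blast
qed

lemma g_equi_positive: "\<exists>c>0. \<forall>n x. \<exists>k::int. c < norm (g n (x + of_int k))"
proof -
  obtain K where K: "K \<ge> 1" "uniformly_large K" using ex_uniformly_large by blast
  have "uniformly_large 1"
    using K
  proof (induction K rule: dec_induct)
    case (step k)
    then show ?case using uniformly_large_step[of k] by simp
  qed simp
  then obtain c where c: "c > 0" "\<And>n S. finite S \<Longrightarrow> card S = 1 \<Longrightarrow> mod1_separated 1 S \<Longrightarrow> large_on n c S"
    unfolding uniformly_large_def by (meson zero_less_one)
  \<comment> \<open>Singletons are vacuously separated; halving \<open>c\<close> makes the
    inequality strict.\<close>
  have "\<exists>k::int. c / 2 < norm (g n (x + of_int k))" for n x
  proof -
    have "large_on n c {frac x}"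
      by (rule c(2)) (auto simp: mod1_separated_def frac_ge_0 frac_lt_1)
    then obtain k where "c \<le> norm (g n (frac x + of_int k))"
      unfolding large_on_def by blast
    then have "c \<le> norm (g n (x + of_int (k - \<lfloor>x\<rfloor>)))"
      by (simp add: frac_def algebra_simps)
    then show ?thesis using c(1) by (intro exI[of _ "k - \<lfloor>x\<rfloor>"]) linarith
  qed
  with c(1) show ?thesis by (intro exI[of _ "c / 2"]) auto
qed

end

section \<open>Completeness of exponentials\<close>

text \<open>Frequency 0 shows that the positive and negative parts of \<open>f\<close> have equal
  mass \<open>c\<close>. If \<open>c > 0\<close>, both normalize to densities with the same
  characteristic function, which agree by Levy uniqueness.\<close>

lemma AE_eq_0_if_orthogonal_exponentials_real:
  fixes f :: "real \<Rightarrow> real"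
  assumes M: "real_distribution M" and f: "integrable M f"
    and orth: "\<And>\<xi>. (CLINT x|M. of_real (f x) * ee (x * \<xi>)) = 0"
  shows "AE x in M. f x = 0"
proof -
  interpret real_distribution M by fact
  have [measurable]: "f \<in> borel_measurable M" using f by simp
  define fp fm where "fp x = max 0 (f x)" and "fm x = max 0 (- f x)" for x
  have int: "integrable M fp" "integrable M fm"
    using f unfolding fp_def fm_def by auto
  have [measurable]: "fp \<in> borel_measurable M" "fm \<in> borel_measurable M" using int by simp_all
  have nn: "fp x \<ge> 0" "fm x \<ge> 0" "f x = fp x - fm x" for x by (auto simp: fp_def fm_def)
  have inte: "integrable M (\<lambda>x. complex_of_real (h x) * ee (x * \<xi>))" if "integrable M h" for h \<xi>
  proof (rule Bochner_Integration.integrable_bound[OF that])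
    show "(\<lambda>x. complex_of_real (h x) * ee (x * \<xi>)) \<in> borel_measurable M"
      using that by measurable
  qed (simp add: norm_mult)
  have eq: "(CLINT x|M. of_real (fp x) * ee (x * \<xi>)) = (CLINT x|M. of_real (fm x) * ee (x * \<xi>))" for \<xi>
  proof -
    have "(CLINT x|M. of_real (f x) * ee (x * \<xi>)) = (CLINT x|M. of_real (fp x) * ee (x * \<xi>) - of_real (fm x) * ee (x * \<xi>))"
      by (intro Bochner_Integration.integral_cong refl) (simp add: nn(3) left_diff_distrib)
    then show ?thesis
      using orth[of \<xi>] by (simp add: inte int)
  qed
  define c where "c = (LINT x|M. fp x)"
  have cm: "c = (LINT x|M. fm x)"
    using eq[of 0] by (simp add: c_def)
  have c0: "c \<ge> 0" unfolding c_def by (intro integral_nonneg_AE) (simp add: nn)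
  show ?thesis
  proof (cases "c = 0")
    case True
    have "AE x in M. fp x = 0"
      using True int nn integral_nonneg_eq_0_iff_AE[of M fp] by (simp add: c_def)
    moreover have "AE x in M. fm x = 0"
      using True cm int nn integral_nonneg_eq_0_iff_AE[of M fm] by simp
    ultimately show ?thesis by eventually_elim (simp add: nn(3))
  next
    case False
    then have c: "c > 0" using c0 by simp
    have dist: "real_distribution (density M (\<lambda>x. ennreal (h x / c)))"
      if h: "integrable M h" "\<And>x. h x \<ge> 0" "(LINT x|M. h x) = c" for h
    proof -
      have [measurable]: "h \<in> borel_measurable M" using h by simp
      have "(\<integral>\<^sup>+ x. ennreal (h x / c) \<partial>M) = ennreal (LINT x|M. h x / c)"
        using h c by (intro nn_integral_eq_integral) auto
      then have "emeasure (density M (\<lambda>x. ennreal (h x / c))) (space M) = 1"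
        using h(3) c by (simp add: emeasure_density cong: nn_integral_cong)
      then have "prob_space (density M (\<lambda>x. ennreal (h x / c)))"
        by (intro prob_spaceI) simp
      then show ?thesis by (simp add: real_distribution_def real_distribution_axioms_def)
    qed
    have char: "fourier (density M (\<lambda>x. ennreal (h x / c))) \<xi> = (CLINT x|M. of_real (h x) * ee (x * \<xi>)) / of_real c"
      if h: "integrable M h" "\<And>x. h x \<ge> 0" for h \<xi>
    proof -
      have [measurable]: "h \<in> borel_measurable M" using h by simp
      have "fourier (density M (\<lambda>x. ennreal (h x / c))) \<xi> = (CLINT x|M. (h x / c) *\<^sub>R ee (x * \<xi>))"
        unfolding fourier_eq_ee by (rule integral_density) (use h c in auto)
      also have "\<dots> = (CLINT x|M. of_real (h x) * ee (x * \<xi>) / of_real c)"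
        by (simp add: scaleR_conv_of_real)
      finally show ?thesis by simp
    qed
    have "density M (\<lambda>x. ennreal (fp x / c)) = density M (\<lambda>x. ennreal (fm x / c))"
    proof (rule Levy_uniqueness)
      show "char (density M (\<lambda>x. ennreal (fp x / c))) = char (density M (\<lambda>x. ennreal (fm x / c)))"
      proof
        fix t
        have t: "char N t = fourier N (t / (2 * pi))" for N by (simp add: fourier_eq_char)
        show "char (density M (\<lambda>x. ennreal (fp x / c))) t = char (density M (\<lambda>x. ennreal (fm x / c))) t"
          unfolding t char[OF int(1) nn(1)] char[OF int(2) nn(2)] eq ..
      qed
      show "real_distribution (density M (\<lambda>x. ennreal (fp x / c)))"
        by (rule dist[OF int(1) nn(1) c_def[symmetric]])
      show "real_distribution (density M (\<lambda>x. ennreal (fm x / c)))"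
        by (rule dist[OF int(2) nn(2) cm[symmetric]])
    qed
    then have "AE x in M. ennreal (fp x / c) = ennreal (fm x / c)"
      by (subst (asm) density_unique_iff) auto
    then show ?thesis
    proof eventually_elim
      case (elim x)
      then have "fp x / c = fm x / c" using nn c by simp
      then show ?case using c by (simp add: nn(3))
    qed
  qed
qed

lemma borel_measurable_cnj [measurable]: "cnj \<in> borel_measurable borel"
  by (intro borel_measurable_continuous_onI continuous_intros)

text \<open>Conjugating the relation at \<open>- \<xi>\<close> gives the same for
  \<open>cnj f\<close>, hence for the real and imaginary parts.\<close>

lemma AE_eq_0_if_orthogonal_exponentials:
  fixes f :: "real \<Rightarrow> complex"
  assumes M: "real_distribution M" and f: "integrable M f"
    and orth: "\<And>\<xi>. (CLINT x|M. f x * ee (x * \<xi>)) = 0"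
  shows "AE x in M. f x = 0"
proof -
  interpret real_distribution M by fact
  have [measurable]: "f \<in> borel_measurable M" using f by simp
  have int: "integrable M (\<lambda>x. f x * ee (x * \<xi>))" for \<xi>
    by (rule Bochner_Integration.integrable_bound[OF f]) (auto simp: norm_mult)
  have intc: "integrable M (\<lambda>x. cnj (f x) * ee (x * \<xi>))" for \<xi>
    by (rule Bochner_Integration.integrable_bound[OF f]) (auto simp: norm_mult)
  have cnj_orth: "(CLINT x|M. cnj (f x) * ee (x * \<xi>)) = 0" for \<xi>
  proof -
    have "(CLINT x|M. cnj (f x) * ee (x * \<xi>)) = (CLINT x|M. cnj (f x * ee (x * - \<xi>)))"
      by (intro Bochner_Integration.integral_cong refl) (simp add: cnj_ee)
    also have "\<dots> = cnj (CLINT x|M. f x * ee (x * - \<xi>))"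
      by (rule integral_bounded_linear[OF bounded_linear_cnj int])
    finally show ?thesis by (simp only: orth complex_cnj_zero)
  qed
  have "AE x in M. Re (f x) = 0"
  proof (rule AE_eq_0_if_orthogonal_exponentials_real[OF M])
    fix \<xi>
    have "(CLINT x|M. of_real (Re (f x)) * ee (x * \<xi>)) = (CLINT x|M. (f x * ee (x * \<xi>) + cnj (f x) * ee (x * \<xi>)) / 2)"
      by (intro Bochner_Integration.integral_cong refl) (simp add: distrib_right[symmetric] complex_add_cnj)
    also have "\<dots> = 0" by (simp add: int intc orth cnj_orth)
    finally show "(CLINT x|M. of_real (Re (f x)) * ee (x * \<xi>)) = 0" .
  qed (use f in simp)
  moreover have "AE x in M. Im (f x) = 0"
  proof (rule AE_eq_0_if_orthogonal_exponentials_real[OF M])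
    fix \<xi>
    have Im: "complex_of_real (Im z) = (z - cnj z) / (2 * \<i>)" for z
      by (simp add: complex_eq_iff)
    have "(CLINT x|M. of_real (Im (f x)) * ee (x * \<xi>)) = (CLINT x|M. (f x * ee (x * \<xi>) - cnj (f x) * ee (x * \<xi>)) / (2 * \<i>))"
      by (simp only: Im left_diff_distrib[symmetric] times_divide_eq_left)
    also have "\<dots> = 0" by (simp add: int intc orth cnj_orth)
    finally show "(CLINT x|M. of_real (Im (f x)) * ee (x * \<xi>)) = 0" .
  qed (use f in simp)
  ultimately show ?thesis by eventually_elim (simp add: complex_eq_iff)
qed

text \<open>Since \<open>\<Sum>\<lambda>. |\<langle>e\<^sub>\<xi>, e\<^sub>\<lambda>\<rangle>|\<^sup>2 = 1 = \<parallel>e\<^sub>\<xi>\<parallel>\<^sup>2\<close>, each exponential lies in the closed span of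
  the orthonormal system \<open>\<Lambda>\<close>.\<close>
lemma spectral_if_parseval:
  fixes \<Lambda> :: "nat \<Rightarrow> real set"
  assumes M: "real_distribution M"
    and fin: "\<And>n. finite (\<Lambda> n)" and mono: "\<And>n. \<Lambda> n \<subseteq> \<Lambda> (Suc n)"
    and orth: "\<And>n a b. a \<in> \<Lambda> n \<Longrightarrow> b \<in> \<Lambda> n \<Longrightarrow> a \<noteq> b \<Longrightarrow> fourier M (a - b) = 0"
    and parseval: "\<And>\<xi> \<epsilon>. \<epsilon> > 0 \<Longrightarrow> \<exists>n. (\<Sum>a\<in>\<Lambda> n. (norm (fourier M (\<xi> + a)))\<^sup>2) \<ge> 1 - \<epsilon>"
  shows "spectral M"
proof -
  interpret real_distribution M by fact
  define \<Lambda>' where "\<Lambda>' = (\<Union>n. \<Lambda> n)"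
  have e: "cis (2 * pi * a * x) = ee (x * a)" for a x by (simp add: ee_def mult_ac)
  have inner: "(CLINT x|M. ee (x * a) * cnj (ee (x * b))) = fourier M (a - b)" for a b
    by (simp add: fourier_eq_ee ee_diff[symmetric] right_diff_distrib)
  have prob_UNIV: "prob UNIV = 1"
    using prob_space by (simp only: space_eq_univ)
  have integrable_inner: "integrable M (\<lambda>x. ee (x * a) * cnj (ee (x * b)))" for a b
    unfolding ee_diff[symmetric] by simp
  have "countable \<Lambda>'" unfolding \<Lambda>'_def using fin by (auto intro: countable_finite)
  moreover have "fourier M (a - b) = 0" if ab: "a \<in> \<Lambda>'" "b \<in> \<Lambda>'" "a \<noteq> b" for a b
  proof -
    obtain m n where "a \<in> \<Lambda> m" "b \<in> \<Lambda> n" using ab by (auto simp: \<Lambda>'_def)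
    moreover have "\<Lambda> m \<subseteq> \<Lambda> (max m n)" "\<Lambda> n \<subseteq> \<Lambda> (max m n)"
      using lift_Suc_mono_le[of \<Lambda>] mono by auto
    ultimately show ?thesis using orth ab(3) by blast
  qed
  moreover have "AE x in M. f x = 0"
    if f: "f \<in> borel_measurable M" "integrable M (\<lambda>x. (norm (f x))\<^sup>2)"
      and f_orth: "\<And>a. a \<in> \<Lambda>' \<Longrightarrow> (CLINT x|M. f x * cnj (ee (x * a))) = 0" for f :: "real \<Rightarrow> complex"
  proof -
    note f(1)[measurable]
    define I where "I = (LINT x|M. (norm (f x))\<^sup>2)"
    have I: "I \<ge> 0" by (simp add: I_def)
    have f1: "integrable M f"
    proof (rule Bochner_Integration.integrable_bound)
      show "integrable M (\<lambda>x. 1 + (norm (f x))\<^sup>2)" using f(2) by simp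
      have "norm (f x) \<le> 1 + (norm (f x))\<^sup>2" for x
      proof -
        have "2 * norm (f x) \<le> 1 + (norm (f x))\<^sup>2"
          using zero_le_power2[of "norm (f x) - 1"] unfolding power2_diff by simp
        then show ?thesis using norm_ge_zero[of "f x"] by linarith
      qed
      then show "AE x in M. norm (f x) \<le> norm (1 + (norm (f x))\<^sup>2)" by (auto intro: order_trans)
    qed simp
    have fe: "integrable M (\<lambda>x. f x * h x)" if "h \<in> borel_measurable M" "\<And>x. norm (h x) \<le> C" for h C
    proof (rule Bochner_Integration.integrable_bound)
      show "integrable M (\<lambda>x. of_real C * f x)" using f1 by simp
      show "(\<lambda>x. f x * h x) \<in> borel_measurable M" using that by simp
      have "0 \<le> C" using that(2) norm_ge_zero order_trans by blast
      then show "AE x in M. norm (f x * h x) \<le> norm (of_real C * f x)"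
        using that(2) by (auto simp: norm_mult mult.commute[of C] intro!: mult_left_mono)
    qed
    have "(CLINT x|M. f x * cnj (ee (x * \<xi>))) = 0" for \<xi>
    proof -
      have "norm (CLINT x|M. f x * cnj (ee (x * \<xi>))) \<le> \<epsilon>" if \<epsilon>: "\<epsilon> > 0" for \<epsilon>
      proof -
        \<comment> \<open>The parameter of \<open>2ab \<le> s a^2 + b^2 / s\<close>, which replaces
          the Cauchy-Schwarz inequality below; with the bound \<open>s * \<epsilon>\<close> on the
          residual, each half contributes at most \<open>\<epsilon> / 2\<close>.\<close>
        define s where "s = \<epsilon> / (I + 1)"
        have s: "s > 0" "s * I \<le> \<epsilon>" using I \<epsilon> by (auto simp: s_def field_simps)
        obtain n where n: "(\<Sum>a\<in>\<Lambda> n. (norm (fourier M (- \<xi> + a)))\<^sup>2) \<ge> 1 - s * \<epsilon>"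
          using parseval[of "s * \<epsilon>" "- \<xi>"] s \<epsilon> by auto
        \<comment> \<open>The residual of the exponential at \<open>\<xi>\<close> after projection
          onto the span of \<open>\<Lambda> n\<close>. Orthonormality gives it squared norm \<open>1
          - (\<Sum>a\<in>\<Lambda> n. (norm (fourier M (\<xi> - a)))^2)\<close>.\<close>
        define r where "r x = ee (x * \<xi>) - (\<Sum>a\<in>\<Lambda> n. fourier M (\<xi> - a) * ee (x * a))" for x
        have [measurable]: "r \<in> borel_measurable borel" unfolding r_def by measurable
        have rb: "norm (r x) \<le> 1 + (\<Sum>a\<in>\<Lambda> n. norm (fourier M (\<xi> - a)))" for x
          unfolding r_def by (intro order_trans[OF norm_triangle_ineq4] add_mono order_trans[OF norm_sum]) (auto simp: norm_mult)
        have r2: "(LINT x|M. (norm (r x))\<^sup>2) \<le> s * \<epsilon>"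
        proof -
          let ?F = "\<lambda>a. fourier M (\<xi> - a)"
          let ?S = "\<lambda>x. \<Sum>a\<in>\<Lambda> n. ?F a * ee (x * a)"
          have F_cnj: "fourier M (a - \<xi>) = cnj (?F a)" for a
          proof -
            have "fourier M (a - \<xi>) = (CLINT x|M. cnj (ee (x * (\<xi> - a))))"
              unfolding fourier_eq_ee by (intro Bochner_Integration.integral_cong refl) (simp add: cnj_ee algebra_simps)
            then show ?thesis by (simp add: fourier_eq_ee)
          qed
          have "of_real (LINT x|M. (norm (r x))\<^sup>2) = (CLINT x|M. r x * cnj (r x))"
            by (simp add: complex_norm_square[symmetric] del: of_real_power)
          also have "\<dots> = (CLINT x|M. 1 - (\<Sum>a\<in>\<Lambda> n. cnj (?F a) * (ee (x * \<xi>) * cnj (ee (x * a))))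
              - (\<Sum>a\<in>\<Lambda> n. ?F a * (ee (x * a) * cnj (ee (x * \<xi>))))
              + (\<Sum>a\<in>\<Lambda> n. \<Sum>b\<in>\<Lambda> n. ?F a * cnj (?F b) * (ee (x * a) * cnj (ee (x * b)))))"
          proof (intro Bochner_Integration.integral_cong refl)
            fix x
            have 1: "ee (x * \<xi>) * cnj (ee (x * \<xi>)) = 1" by (simp add: complex_norm_square[symmetric])
            have 2: "ee (x * \<xi>) * cnj (?S x) = (\<Sum>a\<in>\<Lambda> n. cnj (?F a) * (ee (x * \<xi>) * cnj (ee (x * a))))"
              by (simp add: sum_distrib_left mult_ac)
            have 3: "?S x * cnj (ee (x * \<xi>)) = (\<Sum>a\<in>\<Lambda> n. ?F a * (ee (x * a) * cnj (ee (x * \<xi>))))"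
              unfolding sum_distrib_right by (simp only: mult.assoc)
            have 4: "?S x * cnj (?S x) = (\<Sum>a\<in>\<Lambda> n. \<Sum>b\<in>\<Lambda> n. ?F a * cnj (?F b) * (ee (x * a) * cnj (ee (x * b))))"
              by (simp add: sum_product mult_ac)
            show "r x * cnj (r x) = 1 - (\<Sum>a\<in>\<Lambda> n. cnj (?F a) * (ee (x * \<xi>) * cnj (ee (x * a))))
              - (\<Sum>a\<in>\<Lambda> n. ?F a * (ee (x * a) * cnj (ee (x * \<xi>))))
              + (\<Sum>a\<in>\<Lambda> n. \<Sum>b\<in>\<Lambda> n. ?F a * cnj (?F b) * (ee (x * a) * cnj (ee (x * b))))"
              unfolding 2[symmetric] 3[symmetric] 4[symmetric] r_def using 1
              by (simp add: algebra_simps)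
          qed
          also have "\<dots> = 1 - (\<Sum>a\<in>\<Lambda> n. cnj (?F a) * ?F a) - (\<Sum>a\<in>\<Lambda> n. ?F a * fourier M (a - \<xi>))
              + (\<Sum>a\<in>\<Lambda> n. \<Sum>b\<in>\<Lambda> n. ?F a * cnj (?F b) * fourier M (a - b))"
            by (simp add: inner integrable_inner prob_UNIV)
          also have "(\<Sum>a\<in>\<Lambda> n. \<Sum>b\<in>\<Lambda> n. ?F a * cnj (?F b) * fourier M (a - b)) = (\<Sum>a\<in>\<Lambda> n. \<Sum>b\<in>\<Lambda> n. if b = a then ?F a * cnj (?F a) else 0)"
          proof (intro sum.cong refl)
            fix a b assume ab: "a \<in> \<Lambda> n" "b \<in> \<Lambda> n"
            have "fourier M 0 = 1" by (simp add: fourier_eq_ee prob_UNIV)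
            then show "?F a * cnj (?F b) * fourier M (a - b) = (if b = a then ?F a * cnj (?F a) else 0)"
              using orth[OF ab] by auto
          qed
          also have "\<dots> = (\<Sum>a\<in>\<Lambda> n. cnj (?F a) * ?F a)"
            using fin by (simp add: mult.commute)
          finally have "of_real (LINT x|M. (norm (r x))\<^sup>2) = 1 - (\<Sum>a\<in>\<Lambda> n. ?F a * cnj (?F a))"
            by (simp add: F_cnj)
          also have "\<dots> = of_real (1 - (\<Sum>a\<in>\<Lambda> n. (norm (?F a))\<^sup>2))"
            by (simp add: complex_norm_square[symmetric])
          finally have "(LINT x|M. (norm (r x))\<^sup>2) = 1 - (\<Sum>a\<in>\<Lambda> n. (norm (?F a))\<^sup>2)"
            by (simp only: of_real_eq_iff)
          moreover have "norm (fourier M (- \<xi> + a)) = norm (?F a)" for a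
            using F_cnj[of a] by simp
          ultimately show ?thesis using n by simp
        qed
        \<comment> \<open>The projection belongs to the span of frequencies orthogonal to
          \<open>f\<close>.\<close>
        have fr: "(CLINT x|M. f x * cnj (ee (x * \<xi>))) = (CLINT x|M. f x * cnj (r x))"
        proof -
          have "(CLINT x|M. f x * cnj (r x)) = (CLINT x|M. f x * cnj (ee (x * \<xi>)) - (\<Sum>a\<in>\<Lambda> n. cnj (fourier M (\<xi> - a)) * (f x * cnj (ee (x * a)))))"
            by (intro Bochner_Integration.integral_cong refl)
               (simp add: r_def right_diff_distrib sum_distrib_left mult_ac)
          also have "\<dots> = (CLINT x|M. f x * cnj (ee (x * \<xi>))) - (\<Sum>a\<in>\<Lambda> n. cnj (fourier M (\<xi> - a)) * (CLINT x|M. f x * cnj (ee (x * a))))"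
            using fe[of "\<lambda>x. cnj (ee (x * _))" 1] by simp
          also have "(\<Sum>a\<in>\<Lambda> n. cnj (fourier M (\<xi> - a)) * (CLINT x|M. f x * cnj (ee (x * a)))) = 0"
            using f_orth by (intro sum.neutral) (auto simp: \<Lambda>'_def)
          finally show ?thesis by simp
        qed
        have ir: "integrable M (\<lambda>x. (norm (r x))\<^sup>2)"
          by (rule integrable_const_bound[of _ "(1 + (\<Sum>a\<in>\<Lambda> n. norm (fourier M (\<xi> - a))))\<^sup>2"])
             (auto intro!: power_mono rb)
        have "norm (CLINT x|M. f x * cnj (r x)) \<le> (LINT x|M. norm (f x * cnj (r x)))"
          by (rule integral_norm_bound)
        also have "\<dots> \<le> (LINT x|M. s / 2 * (norm (f x))\<^sup>2 + (norm (r x))\<^sup>2 / (2 * s))"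
        proof (rule integral_mono)
          show "integrable M (\<lambda>x. norm (f x * cnj (r x)))"
          proof (intro integrable_norm fe)
            show "norm (cnj (r x)) \<le> 1 + (\<Sum>a\<in>\<Lambda> n. norm (fourier M (\<xi> - a)))" for x
              using rb[of x] by simp
          qed simp
          show "integrable M (\<lambda>x. s / 2 * (norm (f x))\<^sup>2 + (norm (r x))\<^sup>2 / (2 * s))"
            using f(2) ir by simp
          fix x
          have "0 \<le> (s * norm (f x) - norm (r x))\<^sup>2" by simp
          then have "2 * s * (norm (f x) * norm (r x)) \<le> s * s * (norm (f x))\<^sup>2 + (norm (r x))\<^sup>2"
            by (simp add: power2_eq_square algebra_simps)
          then have "norm (f x) * norm (r x) \<le> (s * s * (norm (f x))\<^sup>2 + (norm (r x))\<^sup>2) / (2 * s)"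
            using s by (simp add: field_simps)
          also have "\<dots> = s / 2 * (norm (f x))\<^sup>2 + (norm (r x))\<^sup>2 / (2 * s)"
            using s by (simp add: add_divide_distrib)
          finally show "norm (f x * cnj (r x)) \<le> s / 2 * (norm (f x))\<^sup>2 + (norm (r x))\<^sup>2 / (2 * s)"
            by (simp add: norm_mult)
        qed
        also have "\<dots> = s / 2 * I + (LINT x|M. (norm (r x))\<^sup>2) / (2 * s)"
          using f(2) ir by (simp add: I_def)
        also have "\<dots> \<le> \<epsilon> / 2 + (s * \<epsilon>) / (2 * s)"
          using s r2 by (intro add_mono divide_right_mono) auto
        also have "\<dots> = \<epsilon>" using s by simp
        finally show ?thesis unfolding fr .
      qed
      then show ?thesis by (meson dense_ge norm_le_zero_iff)
    qed
    then have "(CLINT x|M. f x * ee (x * \<xi>)) = 0" for \<xi>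
      using \<open>\<And>\<xi>. (CLINT x|M. f x * cnj (ee (x * \<xi>))) = 0\<close>[of "- \<xi>"] by (simp add: cnj_ee)
    then show ?thesis by (rule AE_eq_0_if_orthogonal_exponentials[OF M f1])
  qed
  ultimately show ?thesis
    unfolding spectral_def e inner by (intro conjI exI[of _ \<Lambda>'] prob_space_axioms) auto
qed

section \<open>Spectrality\<close>

context digit_system
begin

lemma scale_dvd_digit_int: "of_int d * scale 0 n / scale 0 (Suc j) \<in> \<int>" if "j < n" for d
proof -
  have "\<exists>k::int. scale 0 n = scale 0 (Suc j) * of_int k"
    using that
  proof (induction n)
    case (Suc n)
    show ?case
    proof (cases "j = n")
      case True
      then show ?thesis by (intro exI[of _ 1]) simp
    next
      case False
      then obtain k where "scale 0 n = scale 0 (Suc j) * of_int k" using Suc by auto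
      then have "scale 0 (Suc n) = scale 0 (Suc j) * of_int (k * p (Suc n))"
        by (simp add: scale_Suc[of 0 n])
      then show ?thesis by blast
    qed
  qed simp
  then obtain k :: int where "scale 0 n = scale 0 (Suc j) * of_int k" by blast
  then have "of_int d * scale 0 n / scale 0 (Suc j) = of_int (d * k)"
    using scale_pos[of 0 "Suc j"] by simp
  then show ?thesis by (metis Ints_of_int)
qed

text \<open>Each denominator in the first \<open>n\<close> factors divides \<open>scale 0 n\<close>.
  Hence shifts made at later levels leave earlier factors unchanged.\<close>

lemma phi_periodic: "phi 0 n (x + scale 0 n * of_int k) = phi 0 n x"
  unfolding phi_def
proof (intro prod.cong refl)
  fix i assume "i \<in> {..<n}"
  then have i: "i < n" by simp
  have "(x + scale 0 n * of_int k) / scale 0 (Suc i) = scale 0 n * of_int k / scale 0 (Suc i) + x / scale 0 (Suc i)"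
    by (simp add: add_divide_distrib)
  moreover have "of_int d * (scale 0 n * of_int k / scale 0 (Suc i)) \<in> \<int>" for d
    using scale_dvd_digit_int[OF i, of "d * k"] by (simp add: mult_ac)
  ultimately show "dmask (D (Suc (0 + i))) ((x + scale 0 n * of_int k) / scale 0 (Suc i)) = dmask (D (Suc (0 + i))) (x / scale 0 (Suc i))"
    by (simp only: dmask_shift)
qed

lemma norm_g_le_phi: "norm (g 0 x) \<le> norm (phi 0 n x)"
  unfolding g_eq_phi[of x n] norm_mult by (intro mult_left_le norm_g_le_1) simp

end

context hadamard_system
begin

text \<open>\<open>freq n\<close> is a spectrum of the \<open>n\<close>-th partial convolution. Each new frequency is shifted by a multiple of
  \<open>scale 0 (n + 1)\<close>, chosen by \<open>K\<close>, so that the transform of the tail \<open>nu p D (n + 1)\<close> stays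
  large there; keeping the residue \<open>0\<close> unshifted makes the sets increase.\<close>
fun freq :: "(nat \<Rightarrow> real \<Rightarrow> int) \<Rightarrow> (nat \<Rightarrow> int set) \<Rightarrow> nat \<Rightarrow> real set" where
  "freq K L' 0 = {0}"
| "freq K L' (Suc n) = (\<lambda>(a, l). a + scale 0 n * of_int l +
      scale 0 (Suc n) * of_int (if l = 0 then 0 else K (Suc n) ((a + scale 0 n * of_int l) / scale 0 (Suc n)))) ` (freq K L' n \<times> L' (Suc n))"

text \<open>Orthogonality and the bound 1 on the sums of squares come from
  \<open>norm (g 0 x) \<le> norm (phi 0 n x)\<close>. No mass escapes in the limit, because a tail
  factor bounded below on \<open>\<Lambda> n\<close> gives the reverse inequality up to a constant,
  uniformly in the frequency.\<close>

lemma spectral_inf_conv: "spectral (inf_conv p D)"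
proof -
  obtain c where c: "c > 0" and K_ex: "\<forall>n x. \<exists>k::int. c < norm (g n (x + of_int k))"
    using g_equi_positive by blast
  obtain K :: "nat \<Rightarrow> real \<Rightarrow> int" where K: "\<And>n x. c < norm (g n (x + of_int (K n x)))"
    using K_ex by metis
  \<comment> \<open>Below 1 so that the frequency 0, at which every \<open>g n\<close> is 1, starts
    the induction for \<open>tail\<close>.\<close>
  define c' where "c' = min c (1 / 2)"
  have c': "c' > 0" "c' < 1" "c' \<le> c" using c by (auto simp: c'_def)
  define L' where "L' n = (\<lambda>l. l - (SOME l. l \<in> L n)) ` L n" for n
  have L': "hadamard_triple (p n) (D n) (L' n)" if "n \<ge> 1" for n
    unfolding L'_def by (rule hadamard_translate[OF had[OF that]])
  have L'0: "0 \<in> L' n" if n: "n \<ge> 1" for n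
  proof -
    have "card (L n) = card (D n)" using had[OF n] by (simp add: hadamard_triple_def)
    then have "L n \<noteq> {}" using finD[OF n] D_ne[OF n] by (metis card_eq_0_iff)
    then have "(SOME l. l \<in> L n) \<in> L n" by (simp add: some_in_eq)
    then show ?thesis unfolding L'_def by (rule rev_image_eqI) simp
  qed
  define \<Lambda> where "\<Lambda> = freq K L'"
  define nxt where "nxt n = (\<lambda>(a, l). a + scale 0 n * of_int l +
      scale 0 (Suc n) * of_int (if l = 0 then 0 else K (Suc n) ((a + scale 0 n * of_int l) / scale 0 (Suc n))))" for n
  have \<Lambda>_0: "\<Lambda> 0 = {0}" and \<Lambda>_Suc: "\<Lambda> (Suc n) = nxt n ` (\<Lambda> n \<times> L' (Suc n))" for n
    by (simp_all add: \<Lambda>_def nxt_def)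
  have nxt: "\<exists>k. nxt n (a, l) = a + scale 0 n * of_int l + scale 0 (Suc n) * of_int k" for n a l
    by (auto simp: nxt_def)
  have fin: "finite (\<Lambda> n)" for n
    by (induction n) (use L' in \<open>auto simp: \<Lambda>_0 \<Lambda>_Suc hadamard_triple_def\<close>)
  have mono: "\<Lambda> n \<subseteq> \<Lambda> (Suc n)" for n
  proof
    fix a assume a: "a \<in> \<Lambda> n"
    have "nxt n (a, 0) = a" by (simp add: nxt_def)
    then show "a \<in> \<Lambda> (Suc n)" unfolding \<Lambda>_Suc using a L'0[of "Suc n"] by force
  qed
  have phi_nxt: "phi 0 n (x + nxt n (a, l)) = phi 0 n (x + a)" for n x a l
  proof -
    obtain k where k: "nxt n (a, l) = a + scale 0 n * of_int l + scale 0 (Suc n) * of_int k" using nxt by blast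
    have "x + nxt n (a, l) = (x + a) + scale 0 n * of_int (l + p (Suc n) * k)"
      by (simp add: k scale_Suc algebra_simps)
    then show ?thesis by (simp only: phi_periodic)
  qed
  have dmask_nxt: "dmask (D (Suc n)) ((x + nxt n (a, l)) / scale 0 (Suc n)) = dmask (D (Suc n)) (((x + a) / scale 0 n + of_int l) / of_int (p (Suc n)))" for n x a l
  proof -
    obtain k where k: "nxt n (a, l) = a + scale 0 n * of_int l + scale 0 (Suc n) * of_int k" using nxt by blast
    have "(x + nxt n (a, l)) / scale 0 (Suc n) = ((x + a) / scale 0 n + of_int l) / of_int (p (Suc n)) + of_int k"
      using scale_pos[of 0 n] p_gt_1[of "Suc n"] by (simp add: k scale_Suc field_simps)
    then show ?thesis by (simp only: dmask_add_int)
  qed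
  \<comment> \<open>Different ancestors make the first \<open>n\<close> factors vanish; equal
    ancestors have different labels, and the last factor vanishes by orthogonality of rows.\<close>
  have phi_orth: "phi 0 n (a - b) = 0" if "a \<in> \<Lambda> n" "b \<in> \<Lambda> n" "a \<noteq> b" for n a b
    using that
  proof (induction n arbitrary: a b)
    case 0
    then show ?case by (simp add: \<Lambda>_0)
  next
    case (Suc n a b)
    obtain a0 l where a: "a = nxt n (a0, l)" "a0 \<in> \<Lambda> n" "l \<in> L' (Suc n)" using Suc.prems by (auto simp: \<Lambda>_Suc)
    obtain b0 m where b: "b = nxt n (b0, m)" "b0 \<in> \<Lambda> n" "m \<in> L' (Suc n)" using Suc.prems by (auto simp: \<Lambda>_Suc)
    obtain k where k: "b = b0 + scale 0 n * of_int m + scale 0 (Suc n) * of_int k" using nxt b by blast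
    show ?case
    proof (cases "a0 = b0")
      case False
      have "phi 0 n (a - b) = phi 0 n (a0 - b)"
        using phi_nxt[of n "- b" a0 l] a by simp
      also have "a0 - b = (a0 - b0) + scale 0 n * of_int (- m - p (Suc n) * k)"
        by (simp add: k scale_Suc algebra_simps)
      also have "phi 0 n \<dots> = 0" unfolding phi_periodic using Suc.IH a b False by simp
      finally show ?thesis by (simp add: phi_Suc)
    next
      case True
      then have "l \<noteq> m" using Suc.prems a b by auto
      have "dmask (D (Suc n)) ((a - b) / scale 0 (Suc n)) = dmask (D (Suc n)) (((- b + a0) / scale 0 n + of_int l) / of_int (p (Suc n)))"
        using dmask_nxt[of n "- b" a0 l] a by simp
      also have "((- b + a0) / scale 0 n + of_int l) / of_int (p (Suc n)) = of_int (l - m) / of_int (p (Suc n)) + of_int (- k)"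
        using True scale_pos[of 0 n] p_gt_1[of "Suc n"] by (simp add: k scale_Suc field_simps)
      also have "dmask (D (Suc n)) \<dots> = 0"
        unfolding dmask_add_int by (rule hadamard_row[OF L']) (use a b \<open>l \<noteq> m\<close> in auto)
      finally show ?thesis by (simp add: phi_Suc)
    qed
  qed
  have inj: "inj_on (nxt n) (\<Lambda> n \<times> L' (Suc n))" for n
  proof (rule inj_onI, clarify)
    fix a l b m assume a: "a \<in> \<Lambda> n" "l \<in> L' (Suc n)" and b: "b \<in> \<Lambda> n" "m \<in> L' (Suc n)" and eq: "nxt n (a, l) = nxt n (b, m)"
    obtain k where k: "nxt n (b, m) = b + scale 0 n * of_int m + scale 0 (Suc n) * of_int k" using nxt by blast
    obtain j where j: "nxt n (a, l) = a + scale 0 n * of_int l + scale 0 (Suc n) * of_int j" using nxt by blast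
    have phi_one: "phi 0 n 0 = 1"
      by (induction n) (simp_all add: phi_Suc dmask_0 finD D_ne)
    have "a = b"
    proof (rule ccontr)
      assume "a \<noteq> b"
      have "a - b = 0 + scale 0 n * of_int (m + p (Suc n) * k - l - p (Suc n) * j)"
        using eq unfolding k j by (simp add: scale_Suc algebra_simps)
      then have "phi 0 n (a - b) = phi 0 n 0" by (simp only: phi_periodic)
      then show False using phi_orth[OF a(1) b(1) \<open>a \<noteq> b\<close>] phi_one by simp
    qed
    moreover have "l = m"
    proof (rule ccontr)
      assume "l \<noteq> m"
      have "scale 0 n * (of_int l + of_int (p (Suc n)) * of_int j) = scale 0 n * (of_int m + of_int (p (Suc n)) * of_int k)"
        using eq \<open>a = b\<close> unfolding k j by (simp add: scale_Suc distrib_left mult.assoc)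
      then have "of_int l + of_int (p (Suc n)) * of_int j = of_int m + of_int (p (Suc n)) * real_of_int k"
        using scale_pos[of 0 n] by simp
      then have "of_int (l - m) / of_int (p (Suc n)) = 0 + real_of_int (k - j)"
        using p_gt_1[of "Suc n"] by (simp add: field_simps)
      then have "dmask (D (Suc n)) (of_int (l - m) / of_int (p (Suc n))) = dmask (D (Suc n)) 0"
        by (simp only: dmask_add_int)
      moreover have "dmask (D (Suc n)) (of_int (l - m) / of_int (p (Suc n))) = 0"
        by (rule hadamard_row[OF L']) (use a b \<open>l \<noteq> m\<close> in auto)
      ultimately show False by (simp add: dmask_0 finD D_ne)
    qed
    ultimately show "a = b \<and> l = m" by simp
  qed
  have phi_parseval: "(\<Sum>a\<in>\<Lambda> n. (norm (phi 0 n (x + a)))\<^sup>2) = 1" for n x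
  proof (induction n)
    case 0
    then show ?case by (simp add: \<Lambda>_0)
  next
    case (Suc n)
    have "(\<Sum>a\<in>\<Lambda> (Suc n). (norm (phi 0 (Suc n) (x + a)))\<^sup>2) =
      (\<Sum>(a, l)\<in>\<Lambda> n \<times> L' (Suc n). (norm (phi 0 (Suc n) (x + nxt n (a, l))))\<^sup>2)"
      unfolding \<Lambda>_Suc by (subst sum.reindex[OF inj]) (simp add: case_prod_beta)
    also have "\<dots> = (\<Sum>a\<in>\<Lambda> n. \<Sum>l\<in>L' (Suc n). (norm (phi 0 (Suc n) (x + nxt n (a, l))))\<^sup>2)"
      by (rule sum.cartesian_product[symmetric])
    also have "\<dots> = (\<Sum>a\<in>\<Lambda> n. (norm (phi 0 n (x + a)))\<^sup>2 * (\<Sum>l\<in>L' (Suc n). (norm (dmask (D (Suc n)) (((x + a) / scale 0 n + of_int l) / of_int (p (Suc n)))))\<^sup>2))"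
      by (simp add: phi_Suc phi_nxt dmask_nxt norm_mult power_mult_distrib sum_distrib_left)
    also have "\<dots> = (\<Sum>a\<in>\<Lambda> n. (norm (phi 0 n (x + a)))\<^sup>2)"
      by (simp add: hadamard_parseval[OF L' D_ne])
    finally show ?case using Suc by simp
  qed
  \<comment> \<open>For \<open>l = 0\<close> the frequency is unchanged and the bound is inherited,
    as the dropped mask has modulus at most 1; otherwise \<open>K\<close> was chosen for it.\<close>
  have tail: "c' < norm (g n (a / scale 0 n))" if "a \<in> \<Lambda> n" for n a
    using that
  proof (induction n arbitrary: a)
    case 0
    then show ?case using c' by (simp add: \<Lambda>_0)
  next
    case (Suc n a)
    obtain a0 l where a: "a = nxt n (a0, l)" "a0 \<in> \<Lambda> n" "l \<in> L' (Suc n)" using Suc.prems by (auto simp: \<Lambda>_Suc)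
    show ?case
    proof (cases "l = 0")
      case True
      then have "a = a0" by (simp add: a nxt_def)
      have "c' < norm (g n (a0 / scale 0 n))" using Suc.IH a by simp
      also have "g n (a0 / scale 0 n) = dmask (D (Suc n)) (a / scale 0 (Suc n)) * g (Suc n) (a / scale 0 (Suc n))"
        by (subst g_Suc) (simp add: \<open>a = a0\<close> scale_Suc)
      also have "norm \<dots> \<le> norm (g (Suc n) (a / scale 0 (Suc n)))"
        unfolding norm_mult by (intro mult_left_le_one_le norm_dmask_le_1) auto
      finally show ?thesis .
    next
      case False
      then have "a / scale 0 (Suc n) = (a0 + scale 0 n * of_int l) / scale 0 (Suc n) + of_int (K (Suc n) ((a0 + scale 0 n * of_int l) / scale 0 (Suc n)))"
        using scale_pos[of 0 "Suc n"] by (simp add: a nxt_def add_divide_distrib)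
      then show ?thesis using K[of "Suc n"] c'(3) by (simp add: order.strict_trans1)
    qed
  qed
  have mono_le: "\<Lambda> m \<subseteq> \<Lambda> n" if "m \<le> n" for m n
    using lift_Suc_mono_le[of \<Lambda>, OF mono that] .
  have M: "real_distribution (inf_conv p D)" unfolding inf_conv_def by (rule nu)
  have fourier: "fourier (inf_conv p D) = g 0" by (simp add: inf_conv_def g_def)
  show ?thesis
  proof (rule spectral_if_parseval[where \<Lambda> = \<Lambda>, OF M fin mono])
    fix n a b assume ab: "a \<in> \<Lambda> n" "b \<in> \<Lambda> n" "a \<noteq> b"
    have "norm (g 0 (a - b)) \<le> norm (phi 0 n (a - b))" by (rule norm_g_le_phi)
    then show "fourier (inf_conv p D) (a - b) = 0" using phi_orth[OF ab] by (simp add: fourier)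
  next
    fix \<xi> \<epsilon> :: real assume \<epsilon>: "\<epsilon> > 0"
    define A where "A n = (\<Sum>a\<in>\<Lambda> n. (norm (g 0 (\<xi> + a)))\<^sup>2)" for n
    have A_le: "A n \<le> 1" for n
      unfolding A_def phi_parseval[of n \<xi>, symmetric] by (intro sum_mono power_mono norm_g_le_phi) auto
    have "incseq A"
      unfolding A_def using mono_le fin by (intro monoI sum_mono2) auto
    then obtain A' where A': "A \<longlonglongrightarrow> A'" "\<And>n. A n \<le> A'"
      using incseq_convergent[of A 1] A_le by blast
    define C where "C = (2 / c')\<^sup>2"
    \<comment> \<open>For large \<open>n\<close> the shift \<open>\<xi> / scale 0 n\<close> costs
      the tail at most \<open>c' / 2\<close>, uniformly in \<open>a\<close>, so the tail stays above
      \<open>c' / 2\<close>.\<close>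
    have ev: "eventually (\<lambda>n. \<forall>a\<in>\<Lambda> n. (norm (phi 0 n (\<xi> + a)))\<^sup>2 \<le> C * (norm (g 0 (\<xi> + a)))\<^sup>2) sequentially"
    proof -
      have "(\<lambda>n. 4 * pi * B * \<bar>\<xi>\<bar> * (1 / 2) ^ n) \<longlonglongrightarrow> 4 * pi * B * \<bar>\<xi>\<bar> * 0"
        by (intro tendsto_intros LIMSEQ_power_zero) simp
      then have "eventually (\<lambda>n. 4 * pi * B * \<bar>\<xi>\<bar> * (1 / 2) ^ n < c' / 2) sequentially"
        using c' by (intro order_tendstoD) auto
      then show ?thesis
      proof eventually_elim
        case (elim n)
        show ?case
        proof
          fix a assume a: "a \<in> \<Lambda> n"
          let ?y = "(\<xi> + a) / scale 0 n"
          have "norm (g n ?y - g n (a / scale 0 n)) \<le> 4 * pi * B * \<bar>?y - a / scale 0 n\<bar>"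
            by (rule g_lipschitz)
          also have "?y - a / scale 0 n = \<xi> / scale 0 n" by (simp add: add_divide_distrib)
          also have "\<bar>\<xi> / scale 0 n\<bar> = \<bar>\<xi>\<bar> / scale 0 n" using scale_pos[of 0 n] by simp
          also have "\<dots> \<le> \<bar>\<xi>\<bar> / 2 ^ n"
            using scale_ge[of n 0] scale_pos[of 0 n] by (intro divide_left_mono) auto
          finally have "norm (g n ?y - g n (a / scale 0 n)) \<le> 4 * pi * B * (\<bar>\<xi>\<bar> / 2 ^ n)"
            using B_nonneg by (simp add: mult_left_mono)
          also have "\<dots> = 4 * pi * B * \<bar>\<xi>\<bar> * (1 / 2) ^ n" by (simp add: power_divide)
          finally have "norm (g n ?y - g n (a / scale 0 n)) < c' / 2" using elim by simp
          then have "c' / 2 \<le> norm (g n ?y)"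
            using tail[OF a] norm_triangle_ineq2[of "g n (a / scale 0 n)" "g n (a / scale 0 n) - g n ?y"]
            by (simp add: norm_minus_commute)
          then have "norm (phi 0 n (\<xi> + a)) * (c' / 2) \<le> norm (phi 0 n (\<xi> + a)) * norm (g n ?y)"
            by (intro mult_left_mono) auto
          also have "\<dots> = norm (g 0 (\<xi> + a))" by (simp add: g_eq_phi[of _ n] norm_mult)
          finally have "norm (phi 0 n (\<xi> + a)) \<le> 2 / c' * norm (g 0 (\<xi> + a))"
            using c' by (simp add: field_simps)
          then have "(norm (phi 0 n (\<xi> + a)))\<^sup>2 \<le> (2 / c' * norm (g 0 (\<xi> + a)))\<^sup>2"
            by (intro power_mono) auto
          then show "(norm (phi 0 n (\<xi> + a)))\<^sup>2 \<le> C * (norm (g 0 (\<xi> + a)))\<^sup>2"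
            by (simp only: C_def power_mult_distrib)
        qed
      qed
    qed
    \<comment> \<open>Parseval's identity for \<open>phi 0 n\<close> is cut at
      \<open>\<Lambda> m\<close>: the finite part converges termwise as \<open>n\<close> grows, and
      the rest is dominated by \<open>C * (A n - A m)\<close>. Letting \<open>m\<close> grow yields
      \<open>A' \<ge> 1\<close>.\<close>
    have split: "1 \<le> A m + C * (A' - A m)" for m
    proof (rule tendsto_le)
      show "(\<lambda>n. (\<Sum>a\<in>\<Lambda> m. (norm (phi 0 n (\<xi> + a)))\<^sup>2) + C * (A n - A m)) \<longlonglongrightarrow> A m + C * (A' - A m)"
      proof -
        show ?thesis
          unfolding A_def[of m] by (intro tendsto_intros phi_tendsto A')
      qed
      show "(\<lambda>n. 1 :: real) \<longlonglongrightarrow> 1" by simp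
      show "eventually (\<lambda>n. 1 \<le> (\<Sum>a\<in>\<Lambda> m. (norm (phi 0 n (\<xi> + a)))\<^sup>2) + C * (A n - A m)) sequentially"
        using ev eventually_ge_at_top[of m]
      proof eventually_elim
        case (elim n)
        have sub: "\<Lambda> m \<subseteq> \<Lambda> n" by (rule mono_le[OF elim(2)])
        have "1 = (\<Sum>a\<in>\<Lambda> n - \<Lambda> m. (norm (phi 0 n (\<xi> + a)))\<^sup>2) + (\<Sum>a\<in>\<Lambda> m. (norm (phi 0 n (\<xi> + a)))\<^sup>2)"
          unfolding phi_parseval[of n \<xi>, symmetric] by (rule sum.subset_diff[OF sub fin])
        also have "(\<Sum>a\<in>\<Lambda> n - \<Lambda> m. (norm (phi 0 n (\<xi> + a)))\<^sup>2) \<le> (\<Sum>a\<in>\<Lambda> n - \<Lambda> m. C * (norm (g 0 (\<xi> + a)))\<^sup>2)"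
          using elim(1) by (intro sum_mono) auto
        also have "\<dots> = C * (A n - A m)"
          unfolding A_def sum_distrib_left[symmetric] using sum.subset_diff[OF sub fin, of "\<lambda>a. (norm (g 0 (\<xi> + a)))\<^sup>2"] by simp
        finally show ?case by simp
      qed
    qed simp
    have "(\<lambda>m. A m + C * (A' - A m)) \<longlonglongrightarrow> A' + C * (A' - A')"
      by (intro tendsto_intros A'(1))
    then have "1 \<le> A' + C * (A' - A')"
      by (rule LIMSEQ_le_const) (use split in auto)
    then have "1 - \<epsilon> < A'" using \<epsilon> by simp
    then have "eventually (\<lambda>n. 1 - \<epsilon> < A n) sequentially"
      using A'(1) by (rule order_tendstoD(1)[rotated])
    then obtain n where "1 - \<epsilon> < A n" by (auto simp: eventually_sequentially)
    then show "\<exists>n. 1 - \<epsilon> \<le> (\<Sum>a\<in>\<Lambda> n. (norm (fourier (inf_conv p D) (\<xi> + a)))\<^sup>2)"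
      unfolding fourier A_def by (intro exI[of _ n]) simp
  qed
qed

end

theorem theorem4p8:
  fixes p :: "nat \<Rightarrow> int" and D L :: "nat \<Rightarrow> int set"
  assumes had: "\<And>n. n \<ge> 1 \<Longrightarrow> hadamard_triple (p n) (D n) (L n)"
    and zeroD: "\<And>n. n \<ge> 1 \<Longrightarrow> 0 \<in> D n"
    and nonneg: "\<And>n d. n \<ge> 1 \<Longrightarrow> d \<in> D n \<Longrightarrow> d \<ge> 0"
    and digit_bd: "\<exists>B::real. \<forall>n\<ge>1. \<forall>d\<in>D n. of_int d / of_int (p n) \<le> B"
    and card_bd: "\<exists>C::nat. \<forall>n\<ge>1. card (D n) \<le> C"
    and limsupT: "{0<..<1} \<subseteq> (\<Inter>n\<in>{1..}. \<Union>k\<in>{n..}. T_set (p k) (D k))"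
    and p_bd: "\<exists>P::int. \<forall>n\<ge>1. p n \<le> P"
  shows "(\<exists>r::nat \<Rightarrow> nat. strict_mono r \<and> (\<forall>k. r k \<ge> 1) \<and>
            equi_positive (range (\<lambda>k. nu p D (r k))))
         \<and> spectral (inf_conv p D)"
proof -
  obtain B where B: "\<And>n d. n \<ge> 1 \<Longrightarrow> d \<in> D n \<Longrightarrow> of_int d / of_int (p n) \<le> (B::real)"
    using digit_bd by blast
  obtain P where P: "\<And>n. n \<ge> 1 \<Longrightarrow> p n \<le> P" using p_bd by blast
  interpret hadamard_system p D B L P
  proof
    show "p n > 1" "finite (D n)" if "n \<ge> 1" for n
      using had[OF that] by (simp_all add: hadamard_triple_def)
    show "\<exists>k\<ge>n. \<xi> \<in> T_set (p k) (D k)" if "n \<ge> 1" "0 < \<xi>" "\<xi> < 1" for n \<xi>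
    proof -
      have "\<xi> \<in> (\<Inter>n\<in>{1..}. \<Union>k\<in>{n..}. T_set (p k) (D k))"
        using that by (intro subsetD[OF limsupT]) simp
      then show ?thesis using that(1) by auto
    qed
  qed (use had zeroD nonneg B P in auto)
  obtain c where "c > 0" "\<And>n x. \<exists>k::int. c < norm (g n (x + of_int k))"
    using g_equi_positive by blast
  then have "equi_positive (range (\<lambda>k. nu p D (Suc k)))"
    unfolding equi_positive_def g_def by blast
  then show ?thesis
    \<comment> \<open>Equi-positivity holds along the whole sequence; \<open>Suc\<close> merely
      starts the indices at 1.\<close>
    using spectral_inf_conv by (intro conjI exI[of _ Suc]) (auto simp: strict_mono_def)
qed

end
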